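(* Let $u,v\in\mathbb{C}$ be such that $\mathrm{Re}(1+\tfrac32u)>0$ and $\mathrm{Re}(1+\tfrac32(u+v))>0$. Then \[ \mathrm{CT}\bigg[\Big(1-\frac{yz}{x^2}\Big)^u\Big(1-\frac{xz}{y^2}\Big)^u\Big(1-\frac{xy}{z^2}\Big)^u\Big(1-\frac xy\Big)^v\Big(1-\frac yz\Big)^v\Big(1-\frac zx\Big)^v\bigg] \] \[ =\frac{\cos(\frac12\pi u)\cos(\frac12\pi v)\,\Gamma(1+\frac32(u+v))\,\Gamma(1+\frac32u)\,\Gamma(1+u)\,\Gamma(1+v)}{\Gamma(1+\frac32u+v)\,\Gamma(1+u+\frac12v)\,\Gamma(1+\frac12(u+v))\,\Gamma(1+\frac12u)^2\,\Gamma(1+\frac12v)}. \]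
   Context: $\mathrm{CT}$ denotes the constant term (coefficient of $x^0y^0z^0$). Each factor is expanded by the binomial series $(1-w)^c=\sum_{N\ge0}(-w)^N\binom cN$, where $\binom cN=(-1)^N(-c)_N/N!$ and $(c)_N=c(c+1)\cdots(c+N-1)$, in the displayed monomial $w$. The constant term is the sum of the coefficients of all terms of the expanded product whose monomial is $1$. This infinite series is read as an iterated sum. In any contributing term the exponents $N_1,N_2,N_3$ chosen from the three factors with exponent $v$ satisfy $N_1+N_2+N_3=3b$ for some integer $b\ge0$. For each fixed $b$ the sum of the contributing terms converges absolutely when $\mathrm{Re}(1+\frac32u)>0$, and one then sums over $b=0,1,2,\dots$. At negative integer values of $v$, where $\Gamma(1+v)$ has a pole, the right-hand side has a removable singularity in $v$ and is understood by continuity; reciprocals of the Gamma function at its poles are $0$. *)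

theory Defs
  imports "HOL-Analysis.Gamma_Function" "HOL-Analysis.Infinite_Sum"
begin

text \<open>A monomial \<open>x\<^sup>i y\<^sup>j z\<^sup>k\<close> is represented by its exponent vector \<open>(i, j, k)\<close>,
  so that products become sums and the monomial \<open>1\<close> is \<open>0\<close>.\<close>

type_synonym monomial = "int \<times> int \<times> int"

fun mono_pow :: "monomial \<Rightarrow> nat \<Rightarrow> monomial" where
  "mono_pow (i, j, k) n = (int n * i, int n * j, int n * k)"

text \<open>Coefficient of \<open>w\<^sup>N\<close> in \<open>(1 - w)\<^sup>c\<close>.  The library's \<open>c gchoose N\<close> is
  \<open>(-1)\<^sup>N (-c)\<^sub>N / N!\<close> (fact \<open>gbinomial_pochhammer\<close>).\<close>

definition binom_coeff :: "complex \<Rightarrow> nat \<Rightarrow> complex" where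
  "binom_coeff c N = (- 1) ^ N * (c gchoose N)"

text \<open>A term of the expanded product is given by the exponents \<open>m\<^sub>1, m\<^sub>2, m\<^sub>3\<close> chosen from
  the factors with exponent \<open>u\<close> and \<open>n\<^sub>1, n\<^sub>2, n\<^sub>3\<close> chosen from those with exponent \<open>v\<close>.\<close>

type_synonym choice = "(nat \<times> nat \<times> nat) \<times> (nat \<times> nat \<times> nat)"

fun term_coeff :: "complex \<Rightarrow> complex \<Rightarrow> choice \<Rightarrow> complex" where
  "term_coeff u v ((m1, m2, m3), (n1, n2, n3)) =
     binom_coeff u m1 * binom_coeff u m2 * binom_coeff u m3 *
     binom_coeff v n1 * binom_coeff v n2 * binom_coeff v n3"

text \<open>The six base monomials are, in order,
  \<open>yz/x\<^sup>2\<close>, \<open>xz/y\<^sup>2\<close>, \<open>xy/z\<^sup>2\<close>, \<open>x/y\<close>, \<open>y/z\<close>, \<open>z/x\<close>.\<close>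

fun term_monomial :: "choice \<Rightarrow> monomial" where
  "term_monomial ((m1, m2, m3), (n1, n2, n3)) =
     mono_pow (-2, 1, 1) m1 + mono_pow (1, -2, 1) m2 + mono_pow (1, 1, -2) m3 +
     mono_pow (1, -1, 0) n1 + mono_pow (0, 1, -1) n2 + mono_pow (-1, 0, 1) n3"

fun v_degree :: "choice \<Rightarrow> nat" where
  "v_degree (_, (n1, n2, n3)) = n1 + n2 + n3"

definition contributing :: "nat \<Rightarrow> choice set" where
  "contributing b = {p. term_monomial p = 0 \<and> v_degree p = 3 * b}"

text \<open>No term with monomial \<open>1\<close> is lost by restricting to degrees of the form \<open>3 b\<close>.\<close>

lemma contributing_exhaustive: "{p. term_monomial p = 0} = (\<Union>b. contributing b)"
proof -
  have "3 dvd v_degree p" if "term_monomial p = 0" for p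
  proof -
    obtain m1 m2 m3 n1 n2 n3 where p: "p = ((m1, m2, m3), (n1, n2, n3))"
      by (metis prod.exhaust)
    from that show ?thesis
      unfolding p by (simp add: zero_prod_def) presburger
  qed
  then show ?thesis
    unfolding contributing_def by (auto simp: dvd_def)
qed

text \<open>The constant term is an iterated sum: for each \<open>b\<close> an absolutely convergent sum over
  the contributing terms, and then the ordered series over \<open>b = 0, 1, 2, \<dots>\<close>, which need
  not converge absolutely as a sum over all terms.  Since \<open>\<Sum>\<^sub>\<infinity>\<close> and \<open>\<Sum>\<close> are total, the
  convergence is recorded separately.\<close>

definition slice :: "complex \<Rightarrow> complex \<Rightarrow> nat \<Rightarrow> complex" where
  "slice u v b = (\<Sum>\<^sub>\<infinity>p\<in>contributing b. term_coeff u v p)"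

definition CT_converges :: "complex \<Rightarrow> complex \<Rightarrow> bool" where
  "CT_converges u v \<longleftrightarrow>
     (\<forall>b. (\<lambda>p. norm (term_coeff u v p)) summable_on contributing b) \<and> summable (slice u v)"

definition CT :: "complex \<Rightarrow> complex \<Rightarrow> complex" where
  "CT u v = (\<Sum>b. slice u v b)"

text \<open>In the library \<open>Gamma\<close> is \<open>0\<close> at its poles and \<open>a / 0 = 0\<close>, so the reciprocals of
  \<open>Gamma\<close> in the denominator have their usual value \<open>0\<close> there.  At a pole of
  \<open>Gamma (1 + v)\<close>, however, the expression is not the intended continuous extension.\<close>

definition closed_form :: "complex \<Rightarrow> complex \<Rightarrow> complex" where
  "closed_form u v =
     cos (1/2 * of_real pi * u) * cos (1/2 * of_real pi * v) *
     Gamma (1 + 3/2 * (u + v)) * Gamma (1 + 3/2 * u) * Gamma (1 + u) * Gamma (1 + v) /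
     (Gamma (1 + 3/2 * u + v) * Gamma (1 + u + 1/2 * v) * Gamma (1 + 1/2 * (u + v)) *
      Gamma (1 + 1/2 * u) ^ 2 * Gamma (1 + 1/2 * v))"

end

theory Submission imports Defs "HOL-Real_Asymp.Real_Asymp" begin

text \<open>
  In the variables \<open>p = x/y\<close>, \<open>q = y/z\<close>, \<open>r = z/x\<close>, subject to \<open>p q r = 1\<close>, the product is
  \<open>F (1 - p)\<^sup>v (1 - q)\<^sup>v (1 - r)\<^sup>v\<close> with \<open>F = (1 - r/p)\<^sup>u (1 - p/q)\<^sup>u (1 - q/r)\<^sup>u\<close>.  The terms with
  \<open>v\<close>-degree \<open>3 b\<close> sum to the coefficient of \<open>(p q r)\<^sup>b\<close> when \<open>p, q, r\<close> are taken to be independent.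
  After symmetrization in \<open>p, q, r\<close> this coefficient is a Morris-type constant term with
  parameter \<open>u/2\<close>.  Aomoto's argument, based on \<open>p \<partial>F/\<partial>p\<close> and on the cancellation of
  \<open>(p + q)/(p - q)\<close> under symmetrization, relates the constant terms with \<open>0, 1, 2, 3\<close> additional
  factors \<open>p, q, r\<close> and hence the coefficients for \<open>b + 1\<close> and \<open>b\<close>.  Thus the slices are multiples of
  the terms of a well-poised hypergeometric series at \<open>1\<close>.  Dixon's theorem evaluates the slice \<open>b = 0\<close> and also the
  sum over \<open>b\<close>.  Dixon's theorem itself follows from a Wilf--Zeilberger pair that shifts the first
  parameter by \<open>2\<close>, together with Tannery's theorem as this parameter tends to infinity.
\<close>

section \<open>Growth of Pochhammer quotients\<close>

text \<open>Only an upper bound is recorded: it suffices for summability and null limits, and it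
  stays meaningful when a leading coefficient vanishes.\<close>

definition order_le :: "(nat \<Rightarrow> complex) \<Rightarrow> real \<Rightarrow> bool" where
  "order_le f s \<longleftrightarrow> (\<lambda>n. norm (f n)) \<in> O(\<lambda>n. real n powr s)"

lemma order_le_mult:
  assumes "order_le f s" "order_le g t"
  shows "order_le (\<lambda>n. f n * g n) (s + t)"
  using landau_o.big_mult[OF assms[unfolded order_le_def]]
  by (simp add: order_le_def norm_mult powr_add)

lemma order_le_add:
  assumes "order_le f s" "order_le g s"
  shows "order_le (\<lambda>n. f n + g n) s"
proof -
  have "(\<lambda>n. norm (f n) + norm (g n)) \<in> O(\<lambda>n. real n powr s)"
    using assms unfolding order_le_def by (rule sum_in_bigo)
  then have "(\<lambda>n. norm (f n + g n)) \<in> O(\<lambda>n. real n powr s)"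
    by (rule landau_o.big.trans[rotated]) (auto intro!: landau_o.big_mono always_eventually norm_triangle_ineq)
  then show ?thesis by (simp add: order_le_def)
qed

lemma order_le_linear: "order_le (\<lambda>n. x + of_nat n * y) 1"
proof -
  have "(\<lambda>n. norm x + real n * norm y) \<in> O(\<lambda>n. real n powr 1)"
    by real_asymp
  moreover have "(\<lambda>n. norm (x + of_nat n * y)) \<in> O(\<lambda>n. norm x + real n * norm y)"
  proof (rule landau_o.big_mono, rule always_eventually, rule allI)
    fix n :: nat
    have "norm (x + of_nat n * y) \<le> norm x + norm (of_nat n * y)" by (rule norm_triangle_ineq)
    also have "\<dots> = norm x + real n * norm y" by (simp add: norm_mult)
    finally show "norm (norm (x + of_nat n * y)) \<le> norm (norm x + real n * norm y)" by simp
  qed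
  ultimately show ?thesis unfolding order_le_def by (rule landau_o.big.trans[rotated])
qed

lemma order_le_inverse_linear: "order_le (\<lambda>n. inverse (x + of_nat n)) (-1)"
proof -
  have ev: "eventually (\<lambda>n. norm (norm (inverse (x + of_nat n))) \<le> norm (1 / (real n - norm x))) sequentially"
    using eventually_gt_at_top[of "nat \<lceil>norm x\<rceil>"]
  proof eventually_elim
    case (elim n)
    then have n: "real n > norm x" by linarith
    have "real n - norm x \<le> norm (x + of_nat n)"
      using norm_triangle_ineq2[of "of_nat n" "- x"] by (simp add: add.commute)
    moreover have "0 < real n - norm x" using n by simp
    ultimately show ?case by (simp add: norm_inverse norm_divide inverse_eq_divide frac_le)
  qed
  have "(\<lambda>n. norm (inverse (x + of_nat n))) \<in> O(\<lambda>n. 1 / (real n - norm x))"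
    by (rule landau_o.big_mono[OF ev])
  also have "(\<lambda>n. 1 / (real n - norm x)) \<in> O(\<lambda>n. real n powr (-1))"
    by real_asymp
  finally show ?thesis by (simp add: order_le_def)
qed

lemma order_le_summable:
  assumes "order_le f s" "s < -1"
  shows "summable (\<lambda>n. norm (f n))"
  by (rule summable_comparison_test_bigo[OF _ assms(1)[unfolded order_le_def]])
     (use assms(2) in \<open>simp add: summable_real_powr_iff\<close>)

lemma order_le_tendsto_0:
  assumes "order_le f s" "s < 0"
  shows "f \<longlonglongrightarrow> 0"
proof -
  have "((\<lambda>n. real n powr s) \<longlongrightarrow> 0) sequentially"
    using assms(2) by (intro tendsto_neg_powr filterlim_real_sequentially)
  then have "(\<lambda>n. real n powr s) \<in> o(\<lambda>_. 1)"
    by (intro smalloI_tendsto) simp_all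
  then have "(\<lambda>n. norm (f n)) \<in> o(\<lambda>_. 1)"
    by (rule landau_o.big_small_trans[OF assms(1)[unfolded order_le_def]])
  then have "((\<lambda>n. norm (f n)) \<longlongrightarrow> 0) sequentially"
    using smalloD_tendsto by fastforce
  then show ?thesis by (rule tendsto_norm_zero_cancel)
qed

text \<open>For negative \<open>i\<close> the function \<open>nat\<close> truncates only finitely
  many indices, and a bounded shift of \<open>n\<close> does not change the order of its
  powers.\<close>

lemma order_le_compose_shift:
  assumes "order_le f s"
  shows "order_le (\<lambda>n. f (nat (int n + i))) s"
proof -
  have lim: "filterlim (\<lambda>n. nat (int n + i)) sequentially sequentially"
  proof (rule filterlim_at_top[THEN iffD2], intro allI)
    fix Z show "eventually (\<lambda>n. Z \<le> nat (int n + i)) sequentially"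
      using eventually_ge_at_top[of "nat (int Z + \<bar>i\<bar>)"] by eventually_elim linarith
  qed
  have "(\<lambda>n. norm (f (nat (int n + i)))) \<in> O(\<lambda>n. real (nat (int n + i)) powr s)"
    using landau_o.big.compose[OF assms[unfolded order_le_def] lim] .
  also have "(\<lambda>n. real (nat (int n + i)) powr s) \<in> \<Theta>(\<lambda>n. (real n + real_of_int i) powr s)"
  proof (rule bigthetaI_cong)
    show "eventually (\<lambda>n. real (nat (int n + i)) powr s = (real n + real_of_int i) powr s) sequentially"
      using eventually_ge_at_top[of "nat \<bar>i\<bar>"]
    proof eventually_elim
      case (elim n)
      then have "real (nat (int n + i)) = real n + real_of_int i" by (simp add: of_nat_nat)
      then show ?case by simp
    qed
  qed
  also have "(\<lambda>n. (real n + real_of_int i) powr s) \<in> O(\<lambda>n. real n powr s)"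
    by real_asymp
  finally show ?thesis by (simp add: order_le_def)
qed

section \<open>Asymptotics of Pochhammer symbols\<close>

lemma pochhammer_over_fact_tendsto:
  "(\<lambda>n. pochhammer z n / fact n * exp ((1 - z) * of_real (ln (real n)))) \<longlonglongrightarrow> rGamma (z :: complex)"
proof -
  have "(\<lambda>n. ((-z) gchoose n) / ((-1)^n / exp ((-z+1) * of_real (ln (real n))))) \<longlonglongrightarrow> inverse (Gamma (- (-z)))"
    by (rule gbinomial_asymptotic)
  also have "(\<lambda>n. ((-z) gchoose n) / ((-1)^n / exp ((-z+1) * of_real (ln (real n))))) =
      (\<lambda>n. pochhammer z n / fact n * exp ((1 - z) * of_real (ln (real n))))"
    by (rule ext) (simp add: gbinomial_pochhammer add.commute field_simps)
  finally show ?thesis by (simp add: rGamma_inverse_Gamma)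
qed

lemma norm_exp_times_ln:
  assumes "n > 0"
  shows "norm (exp (z * of_real (ln (real n)))) = real n powr Re z"
  using assms by (simp add: norm_exp_eq_Re powr_def)

text \<open>The quotient behaves like \<open>rGamma z\<close> times n^(z-1); at the zeros of
  \<open>rGamma\<close> the bound is simply not sharp.\<close>

lemma order_le_pochhammer_over_fact: "order_le (\<lambda>n. pochhammer z n / fact n) (Re z - 1)"
proof -
  have "(\<lambda>n. norm (pochhammer z n / fact n) * real n powr (1 - Re z)) \<longlonglongrightarrow> norm (rGamma z)"
  proof (rule Lim_transform_eventually[OF tendsto_norm[OF pochhammer_over_fact_tendsto]])
    show "eventually (\<lambda>n. norm (pochhammer z n / fact n * exp ((1 - z) * of_real (ln (real n))))
        = norm (pochhammer z n / fact n) * real n powr (1 - Re z)) sequentially"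
      using eventually_gt_at_top[of 0]
      by eventually_elim (simp only: norm_mult norm_exp_times_ln, simp)
  qed
  then have "(\<lambda>n. norm (pochhammer z n / fact n) * real n powr (1 - Re z)) \<in> O(\<lambda>_. 1)"
    by (intro bigoI_tendsto[where c = "norm (rGamma z)"]) simp_all
  then have "(\<lambda>n. real n powr (Re z - 1) * (norm (pochhammer z n / fact n) * real n powr (1 - Re z)))
      \<in> O(\<lambda>n. real n powr (Re z - 1) * 1)"
    by (intro landau_o.big_mult) auto
  moreover have ev: "eventually (\<lambda>n. real n powr (Re z - 1) * (norm (pochhammer z n / fact n) * real n powr (1 - Re z))
      = norm (pochhammer z n / fact n)) sequentially"
    using eventually_gt_at_top[of 0]
    by eventually_elim (simp only: powr_diff, simp)
  ultimately show ?thesis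
    unfolding order_le_def by (simp add: landau_o.big.in_cong[OF ev])
qed

text \<open>Here the limit \<open>rGamma z\<close> is inverted, so its zeros, the nonpositive
  integers, are excluded.\<close>

lemma order_le_fact_over_pochhammer:
  assumes "z \<notin> \<int>\<^sub>\<le>\<^sub>0"
  shows "order_le (\<lambda>n. fact n / pochhammer z n) (1 - Re z)"
proof -
  have nz: "norm (rGamma z) \<noteq> 0" using assms by (simp add: rGamma_eq_zero_iff)
  have "(\<lambda>n. norm (fact n / pochhammer z n) * real n powr (Re z - 1)) \<longlonglongrightarrow> inverse (norm (rGamma z))"
  proof (rule Lim_transform_eventually[OF tendsto_inverse[OF tendsto_norm[OF pochhammer_over_fact_tendsto] nz]])
    show "eventually (\<lambda>n. inverse (norm (pochhammer z n / fact n * exp ((1 - z) * of_real (ln (real n)))))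
        = norm (fact n / pochhammer z n) * real n powr (Re z - 1)) sequentially"
      using eventually_gt_at_top[of 0]
      by eventually_elim
         (simp only: norm_mult norm_exp_times_ln, simp add: norm_divide powr_diff field_simps)
  qed
  then have "(\<lambda>n. norm (fact n / pochhammer z n) * real n powr (Re z - 1)) \<in> O(\<lambda>_. 1)"
    by (intro bigoI_tendsto[where c = "inverse (norm (rGamma z))"]) simp_all
  then have "(\<lambda>n. real n powr (1 - Re z) * (norm (fact n / pochhammer z n) * real n powr (Re z - 1)))
      \<in> O(\<lambda>n. real n powr (1 - Re z) * 1)"
    by (intro landau_o.big_mult) auto
  moreover have ev: "eventually (\<lambda>n. real n powr (1 - Re z) * (norm (fact n / pochhammer z n) * real n powr (Re z - 1))
      = norm (fact n / pochhammer z n)) sequentially"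
    using eventually_gt_at_top[of 0]
    by eventually_elim (simp only: powr_diff, simp)
  ultimately show ?thesis
    unfolding order_le_def by (simp add: landau_o.big.in_cong[OF ev])
qed

lemma order_le_mono:
  assumes "order_le f s" "s \<le> t"
  shows "order_le f t"
proof -
  have "(\<lambda>n. real n powr s) \<in> O(\<lambda>n. real n powr t)"
  proof (rule landau_o.big_mono)
    show "eventually (\<lambda>n. norm (real n powr s) \<le> norm (real n powr t)) sequentially"
      using eventually_ge_at_top[of 1] by eventually_elim (use assms(2) in \<open>simp add: powr_mono\<close>)
  qed
  then show ?thesis
    using assms(1) unfolding order_le_def by (blast intro: landau_o.big.trans)
qed

lemma order_le_const: "order_le (\<lambda>_. c) 0"
proof -
  have "(\<lambda>_. norm c) \<in> O(\<lambda>n. real n powr 0)" by real_asymp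
  then show ?thesis by (simp only: order_le_def)
qed

section \<open>Dixon's theorem\<close>

text \<open>These are the terms of the well-poised 3F2 series at 1.\<close>

definition dixon_term :: "complex \<Rightarrow> complex \<Rightarrow> complex \<Rightarrow> nat \<Rightarrow> complex" where
  "dixon_term a b c n = pochhammer a n * pochhammer b n * pochhammer c n /
     (fact n * pochhammer (1 + a - b) n * pochhammer (1 + a - c) n)"

text \<open>In the classical value the quotient Gamma(1+a/2)/Gamma(1+a) is replaced, by the
  duplication formula, with an entire function of \<open>a\<close>; negative integers
  \<open>a\<close> then need no separate treatment.\<close>

definition dixon_value :: "complex \<Rightarrow> complex \<Rightarrow> complex \<Rightarrow> complex" where
  "dixon_value a b c = of_real (sqrt pi) * exp (- a * of_real (ln 2)) * rGamma ((1 + a) / 2) *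
     Gamma (1 + a / 2 - b - c) * Gamma (1 + a - b) * Gamma (1 + a - c) *
     rGamma (1 + a - b - c) * rGamma (1 + a / 2 - b) * rGamma (1 + a / 2 - c)"

text \<open>The parameter \<open>d\<close> is kept apart from \<open>a\<close>: the series has
  \<open>d = a\<close>, its certificate \<open>d = a + 1\<close>, and the majorant used for
  Tannery's theorem is another instance.\<close>

lemma order_le_well_poised:
  assumes "1 + a - b \<notin> \<int>\<^sub>\<le>\<^sub>0" "1 + a - c \<notin> \<int>\<^sub>\<le>\<^sub>0"
  shows "order_le (\<lambda>n. pochhammer d n * pochhammer b n * pochhammer c n /
     (fact n * pochhammer (1 + a - b) n * pochhammer (1 + a - c) n)) (Re (d - 2 * a + 2 * b + 2 * c) - 3)"
proof -
  have "order_le (\<lambda>n. (pochhammer d n / fact n) * (pochhammer b n / fact n) * (pochhammer c n / fact n) *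
     (fact n / pochhammer (1 + a - b) n) * (fact n / pochhammer (1 + a - c) n))
     ((Re d - 1) + (Re b - 1) + (Re c - 1) + (1 - Re (1 + a - b)) + (1 - Re (1 + a - c)))"
    by (intro order_le_mult order_le_pochhammer_over_fact order_le_fact_over_pochhammer assms)
  moreover have "(pochhammer d n / fact n) * (pochhammer b n / fact n) * (pochhammer c n / fact n) *
     (fact n / pochhammer (1 + a - b) n) * (fact n / pochhammer (1 + a - c) n) =
     pochhammer d n * pochhammer b n * pochhammer c n /
     (fact n * pochhammer (1 + a - b) n * pochhammer (1 + a - c) n)" for n
    by simp
  ultimately show ?thesis by (simp add: algebra_simps)
qed

text \<open>With \<open>d = a\<close> the order is \<open>Re (2 * b + 2 * c - a) - 3\<close>, which
  is below -1 exactly under the third hypothesis.\<close>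

lemma summable_dixon_term:
  assumes "1 + a - b \<notin> \<int>\<^sub>\<le>\<^sub>0" "1 + a - c \<notin> \<int>\<^sub>\<le>\<^sub>0" "Re (1 + a / 2 - b - c) > 0"
  shows "summable (\<lambda>n. norm (dixon_term a b c n))"
  unfolding dixon_term_def
  by (rule order_le_summable[OF order_le_well_poised[OF assms(1,2)]]) (use assms(3) in simp)

text \<open>The Wilf--Zeilberger certificate for the shift of \<open>a\<close> by \<open>2\<close>; the index \<open>0\<close> is split off
  because the certificate, as a multiple of \<open>dixon_term a b c n\<close>, has a pole at \<open>a = 0\<close>.\<close>

definition dixon_cert :: "complex \<Rightarrow> complex \<Rightarrow> complex \<Rightarrow> nat \<Rightarrow> complex" where
  "dixon_cert a b c m =
     (2 * (1 + a - b - c) * (1 - b) * (1 - c) - a * (of_nat (Suc m) + (1 + a - b)) * (of_nat (Suc m) + (1 + a - c))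
       - a * (1 + a - b - c) * (of_nat (Suc m) + a)) *
     pochhammer (a + 1) m * pochhammer b (Suc m) * pochhammer c (Suc m) /
     (fact m * pochhammer (1 + a - b) (Suc (Suc m)) * pochhammer (1 + a - c) (Suc (Suc m)))"

lemma not_nonpos_Int_add_nat:
  "z \<notin> \<int>\<^sub>\<le>\<^sub>0 \<Longrightarrow> z + of_nat n \<noteq> (0 :: complex)"
  by (metis add.commute add_eq_0_iff nonpos_Ints_of_int minus_of_nat_in_nonpos_Ints add.inverse_inverse plus_of_nat_eq_0_imp)

lemma nonpos_Int_shift:
  assumes "z \<notin> \<int>\<^sub>\<le>\<^sub>0"
  shows "z + of_nat n \<notin> (\<int>\<^sub>\<le>\<^sub>0 :: complex set)"
proof
  assume "z + of_nat n \<in> \<int>\<^sub>\<le>\<^sub>0"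
  then obtain k where "z + of_nat n = - of_nat k" by (auto elim: nonpos_Ints_cases')
  then have "z = - of_nat k - of_nat n" by (simp only: eq_diff_eq)
  then have "z = - of_nat (k + n)" by simp
  with assms show False by (simp only: minus_of_nat_in_nonpos_Ints) simp
qed

text \<open>All terms are rational multiples of one Pochhammer product, so a polynomial identity
  remains. The second equation is the first with the preceding certificate read as 0; hence partial
  sums equal the certificate.\<close>

lemma dixon_cert_telescopes:
  fixes a b c :: complex
  defines "B \<equiv> 1 + a - b" and "C \<equiv> 1 + a - c" and "F \<equiv> 1 + a - b - c"
  assumes B: "B \<notin> \<int>\<^sub>\<le>\<^sub>0" and C: "C \<notin> \<int>\<^sub>\<le>\<^sub>0"
  shows "(2 + a - 2 * b - 2 * c) * dixon_term a b c (Suc m) -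
      (a + 1) * F * (F + 1) * (2 + a - 2 * b) * (2 + a - 2 * c) / (B * (B + 1) * C * (C + 1)) *
        dixon_term (a + 2) b c (Suc m) = dixon_cert a b c (Suc m) - dixon_cert a b c m"
    and "(2 + a - 2 * b - 2 * c) * dixon_term a b c 0 -
      (a + 1) * F * (F + 1) * (2 + a - 2 * b) * (2 + a - 2 * c) / (B * (B + 1) * C * (C + 1)) *
        dixon_term (a + 2) b c 0 = dixon_cert a b c 0"
proof -
  have nzB: "B + of_nat k \<noteq> 0" and nzC: "C + of_nat k \<noteq> 0" for k
    using B C not_nonpos_Int_add_nat by auto
  have nzs: "B \<noteq> 0" "B + 1 \<noteq> 0" "C \<noteq> 0" "C + 1 \<noteq> 0"
    using nzB[of 0] nzB[of 1] nzC[of 0] nzC[of 1] by simp_all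
  have pB: "pochhammer B k \<noteq> 0" and pC: "pochhammer C k \<noteq> 0" for k
    using nzB nzC by (auto simp: pochhammer_eq_0_iff eq_neg_iff_add_eq_0)
  show "(2 + a - 2 * b - 2 * c) * dixon_term a b c 0 -
      (a + 1) * F * (F + 1) * (2 + a - 2 * b) * (2 + a - 2 * c) / (B * (B + 1) * C * (C + 1)) *
        dixon_term (a + 2) b c 0 = dixon_cert a b c 0"
  proof -
    have divide: "X - Y / N = Z / N" if "X * N - Y = Z" "N \<noteq> 0" for X Y Z N :: complex
      using that by (auto simp: diff_divide_distrib)
    have "(2 + a - 2 * b - 2 * c) * (B * (B + 1) * C * (C + 1)) -
        (a + 1) * F * (F + 1) * (2 + a - 2 * b) * (2 + a - 2 * c) =
        (2 * F * (1 - b) * (1 - c) - a * (1 + B) * (1 + C) - a * F * (1 + a)) * b * c"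
      unfolding B_def C_def F_def by algebra
    then have "(2 + a - 2 * b - 2 * c) -
        (a + 1) * F * (F + 1) * (2 + a - 2 * b) * (2 + a - 2 * c) / (B * (B + 1) * C * (C + 1)) =
        (2 * F * (1 - b) * (1 - c) - a * (1 + B) * (1 + C) - a * F * (1 + a)) * b * c / (B * (B + 1) * C * (C + 1))"
      by (rule divide) (use nzs in simp)
    then show ?thesis
      by (simp add: dixon_term_def dixon_cert_def B_def C_def F_def pochhammer_Suc mult_ac)
  qed
  define k where "k = (of_nat m :: complex)"
  have Suc_k: "of_nat (Suc m) = k + 1" "of_nat (Suc (Suc m)) = k + 2"
    by (simp_all add: k_def)
  have nzk: "B + k \<noteq> 0" "B + k + 1 \<noteq> 0" "B + k + 2 \<noteq> 0" "C + k \<noteq> 0" "C + k + 1 \<noteq> 0" "C + k + 2 \<noteq> 0" "k + 1 \<noteq> 0"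
    using nzB[of m] nzB[of "Suc m"] nzB[of "Suc (Suc m)"] nzC[of m] nzC[of "Suc m"] nzC[of "Suc (Suc m)"]
    unfolding Suc_k by (simp_all add: k_def add_ac, metis Suc_eq_plus1_left of_nat_Suc of_nat_neq_0)
  show "(2 + a - 2 * b - 2 * c) * dixon_term a b c (Suc m) -
      (a + 1) * F * (F + 1) * (2 + a - 2 * b) * (2 + a - 2 * c) / (B * (B + 1) * C * (C + 1)) *
        dixon_term (a + 2) b c (Suc m) = dixon_cert a b c (Suc m) - dixon_cert a b c m"
  proof -
    \<comment> \<open>\<open>D / N\<close> is the common factor. Using
      \<open>pochhammer (a + 1) m\<close> keeps \<open>a\<close> as a numerator factor, so nothing
      is divided by \<open>a\<close> and \<open>a = 0\<close> is covered.\<close>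
    define D where "D = pochhammer (a + 1) m * pochhammer b (Suc m) * pochhammer c (Suc m) /
      (fact m * pochhammer B m * pochhammer C m)"
    define N where "N = (k + 1) * (B + k) * (B + k + 1) * (B + k + 2) * (C + k) * (C + k + 1) * (C + k + 2)"
    define p where "p n = 2 * F * (1 - b) * (1 - c) - a * (n + B) * (n + C) - a * F * (n + a)" for n
    have FB: "F = B - c" by (simp add: F_def B_def)
    have N: "N \<noteq> 0" using nzk by (simp add: N_def)
    have fm: "(fact m :: complex) \<noteq> 0" by simp
    have t1: "dixon_term a b c (Suc m) = D * (a * (B + k + 1) * (B + k + 2) * (C + k + 1) * (C + k + 2)) / N"
      using nzk pB[of m] pC[of m] fm
      unfolding dixon_term_def D_def N_def B_def[symmetric] C_def[symmetric]
        pochhammer_rec[of a] pochhammer_Suc[of B] pochhammer_Suc[of C] fact_Suc k_def[symmetric] Suc_k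
      by (simp add: divide_simps)
    \<comment> \<open>\<open>pochhammer x (m + 3)\<close> is split at either end, which converts
      denominators based at \<open>B + 2\<close> and \<open>C + 2\<close> into those based at
      \<open>B\<close> and \<open>C\<close>.\<close>
    have shift: "pochhammer x m * (x + k) * (x + k + 1) * (x + k + 2) = x * (x + 1) * pochhammer (x + 2) (Suc m)" for x
    proof -
      have "pochhammer x (Suc (Suc (Suc m))) = x * ((x + 1) * pochhammer (x + 2) (Suc m))"
        by (simp only: pochhammer_rec) (simp add: add_ac)
      moreover have "pochhammer x (Suc (Suc (Suc m))) = pochhammer x m * (x + k) * (x + k + 1) * (x + k + 2)"
        by (simp only: pochhammer_Suc Suc_k k_def[symmetric]) (simp add: add_ac)
      ultimately show ?thesis by simp
    qed
    have pa: "(a + 1) * pochhammer (a + 2) (Suc m) = pochhammer (a + 1) m * (a + 1 + k) * (a + 2 + k)"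
    proof -
      have "pochhammer (a + 1) (Suc (Suc m)) = (a + 1) * pochhammer (a + 2) (Suc m)"
        by (subst pochhammer_rec) (simp add: add_ac)
      moreover have "pochhammer (a + 1) (Suc (Suc m)) = pochhammer (a + 1) m * (a + 1 + k) * (a + 2 + k)"
        by (simp only: pochhammer_Suc Suc_k k_def[symmetric]) (simp add: add_ac)
      ultimately show ?thesis by simp
    qed
    have B2: "1 + (a + 2) - b = B + 2" and C2: "1 + (a + 2) - c = C + 2"
      by (simp_all add: B_def C_def)
    have "(a + 1) / (B * (B + 1) * C * (C + 1)) * dixon_term (a + 2) b c (Suc m) =
        ((a + 1) * pochhammer (a + 2) (Suc m)) * pochhammer b (Suc m) * pochhammer c (Suc m) /
        (fact (Suc m) * (B * (B + 1) * pochhammer (B + 2) (Suc m)) * (C * (C + 1) * pochhammer (C + 2) (Suc m)))"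
      unfolding dixon_term_def B2 C2 by (simp only: divide_inverse inverse_mult_distrib mult_ac)
    also have "\<dots> = D * ((a + 1 + k) * (a + 2 + k)) / N"
      unfolding pa shift[symmetric] D_def N_def fact_Suc Suc_k by (simp add: divide_simps)
    finally have t2: "(a + 1) / (B * (B + 1) * C * (C + 1)) * dixon_term (a + 2) b c (Suc m) =
        D * ((a + 1 + k) * (a + 2 + k)) / N" .
    have g1: "dixon_cert a b c (Suc m) = D * (p (k + 2) * (a + 1 + k) * (b + k + 1) * (c + k + 1)) / N"
      using nzk pB[of m] pC[of m] fm
      unfolding dixon_cert_def D_def N_def p_def B_def[symmetric] C_def[symmetric] F_def[symmetric]
        pochhammer_Suc[of "a + 1"] pochhammer_Suc[of b "Suc m"] pochhammer_Suc[of c "Suc m"]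
        pochhammer_Suc[of B] pochhammer_Suc[of C] fact_Suc k_def[symmetric] Suc_k
      by (simp add: divide_simps add_ac FB)
    have g0: "dixon_cert a b c m = D * ((k + 1) * p (k + 1) * (B + k + 2) * (C + k + 2)) / N"
      using nzk pB[of m] pC[of m] fm
      unfolding dixon_cert_def D_def N_def p_def B_def[symmetric] C_def[symmetric] F_def[symmetric]
        pochhammer_Suc[of B] pochhammer_Suc[of C] k_def[symmetric] Suc_k
      by (simp add: divide_simps add_ac FB)
    have factor: "X * (D * Y / N) - X' * (D * Y' / N) = D / N * (X * Y - X' * Y')" for X Y X' Y'
      by (simp add: algebra_simps)
    have poly: "(2 + a - 2 * b - 2 * c) * (a * (B + k + 1) * (B + k + 2) * (C + k + 1) * (C + k + 2)) -
        F * (F + 1) * (2 + a - 2 * b) * (2 + a - 2 * c) * ((a + 1 + k) * (a + 2 + k)) =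
        p (k + 2) * (a + 1 + k) * (b + k + 1) * (c + k + 1) - (k + 1) * p (k + 1) * (B + k + 2) * (C + k + 2)"
      unfolding p_def B_def C_def F_def by algebra
    have "(2 + a - 2 * b - 2 * c) * dixon_term a b c (Suc m) -
        (a + 1) * F * (F + 1) * (2 + a - 2 * b) * (2 + a - 2 * c) / (B * (B + 1) * C * (C + 1)) *
        dixon_term (a + 2) b c (Suc m) =
        (2 + a - 2 * b - 2 * c) * dixon_term a b c (Suc m) -
        F * (F + 1) * (2 + a - 2 * b) * (2 + a - 2 * c) *
        ((a + 1) / (B * (B + 1) * C * (C + 1)) * dixon_term (a + 2) b c (Suc m))"
      by simp
    also have "\<dots> = D / N * ((2 + a - 2 * b - 2 * c) * (a * (B + k + 1) * (B + k + 2) * (C + k + 1) * (C + k + 2)) -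
        F * (F + 1) * (2 + a - 2 * b) * (2 + a - 2 * c) * ((a + 1 + k) * (a + 2 + k)))"
      unfolding t1 t2 by (rule factor)
    also have "\<dots> = dixon_cert a b c (Suc m) - dixon_cert a b c m"
      unfolding poly g1 g0 by (simp only: right_diff_distrib times_divide_eq_left)
    finally show ?thesis .
  qed
qed

text \<open>The quadratic factor and the two extra numerator factors are balanced in degree by four
  extra denominator factors. What remains has order \<open>Re (2 * b + 2 * c - a) - 2\<close>,
  negative by the convergence hypothesis.\<close>

lemma dixon_cert_tendsto_0:
  assumes B: "1 + a - b \<notin> \<int>\<^sub>\<le>\<^sub>0" and C: "1 + a - c \<notin> \<int>\<^sub>\<le>\<^sub>0" and conv: "Re (1 + a / 2 - b - c) > 0"
  shows "dixon_cert a b c \<longlonglongrightarrow> 0"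
proof -
  let ?B = "1 + a - b" and ?C = "1 + a - c" and ?F = "1 + a - b - c"
  let ?w = "\<lambda>m. pochhammer (a + 1) m * pochhammer b m * pochhammer c m /
     (fact m * pochhammer ?B m * pochhammer ?C m)"
  have lin: "order_le (\<lambda>m. x + of_nat m) 1" for x
    using order_le_linear[of x 1] by simp
  have p: "order_le (\<lambda>m. (2 * ?F * (1 - b) * (1 - c)) + ((- a) * ((1 + ?B) + of_nat m) * ((1 + ?C) + of_nat m)
       + (- a * ?F) * ((1 + a) + of_nat m))) 2"
    by (intro order_le_add order_le_mono[OF order_le_const, of 2]
        order_le_mono[OF order_le_mult[OF order_le_mult[OF order_le_const lin] lin], of 2]
        order_le_mono[OF order_le_mult[OF order_le_const lin], of 2]) simp_all
  have "order_le (\<lambda>m. ((2 * ?F * (1 - b) * (1 - c)) + ((- a) * ((1 + ?B) + of_nat m) * ((1 + ?C) + of_nat m)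
       + (- a * ?F) * ((1 + a) + of_nat m))) * ((b + of_nat m) * (c + of_nat m)) *
       (inverse (?B + of_nat m) * inverse (?B + 1 + of_nat m) * inverse (?C + of_nat m) * inverse (?C + 1 + of_nat m))
       * ?w m)
       (2 + (1 + 1) + (-1 + -1 + -1 + -1) + (Re (a + 1 - 2 * a + 2 * b + 2 * c) - 3))"
    by (intro order_le_mult p lin order_le_inverse_linear order_le_well_poised B C)
  also have "(\<lambda>m. ((2 * ?F * (1 - b) * (1 - c)) + ((- a) * ((1 + ?B) + of_nat m) * ((1 + ?C) + of_nat m)
       + (- a * ?F) * ((1 + a) + of_nat m))) * ((b + of_nat m) * (c + of_nat m)) *
       (inverse (?B + of_nat m) * inverse (?B + 1 + of_nat m) * inverse (?C + of_nat m) * inverse (?C + 1 + of_nat m))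
       * ?w m) = dixon_cert a b c"
  proof
    fix m
    have p: "(2 * ?F * (1 - b) * (1 - c)) + ((- a) * ((1 + ?B) + of_nat m) * ((1 + ?C) + of_nat m)
       + (- a * ?F) * ((1 + a) + of_nat m)) = 2 * ?F * (1 - b) * (1 - c) - a * (of_nat (Suc m) + ?B) * (of_nat (Suc m) + ?C)
       - a * ?F * (of_nat (Suc m) + a)"
      by (simp add: algebra_simps)
    have Bm: "?B + of_nat (Suc m) = ?B + 1 + of_nat m" and Cm: "?C + of_nat (Suc m) = ?C + 1 + of_nat m"
      by simp_all
    show "((2 * ?F * (1 - b) * (1 - c)) + ((- a) * ((1 + ?B) + of_nat m) * ((1 + ?C) + of_nat m)
       + (- a * ?F) * ((1 + a) + of_nat m))) * ((b + of_nat m) * (c + of_nat m)) *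
       (inverse (?B + of_nat m) * inverse (?B + 1 + of_nat m) * inverse (?C + of_nat m) * inverse (?C + 1 + of_nat m))
       * ?w m = dixon_cert a b c m"
      unfolding p dixon_cert_def pochhammer_Suc Bm Cm
      by (simp only: divide_inverse inverse_mult_distrib mult_ac)
  qed
  finally show ?thesis
    by (rule order_le_tendsto_0) (use conv in simp)
qed

text \<open>The partial sums of the difference of both sides equal the certificate, which tends to
  0.\<close>

lemma dixon_sum_shift:
  assumes B: "1 + a - b \<notin> \<int>\<^sub>\<le>\<^sub>0" and C: "1 + a - c \<notin> \<int>\<^sub>\<le>\<^sub>0" and conv: "Re (1 + a / 2 - b - c) > 0"
  shows "(2 + a - 2 * b - 2 * c) * suminf (dixon_term a b c) =
      (a + 1) * (1 + a - b - c) * (1 + a - b - c + 1) * (2 + a - 2 * b) * (2 + a - 2 * c) /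
        ((1 + a - b) * (1 + a - b + 1) * (1 + a - c) * (1 + a - c + 1)) * suminf (dixon_term (a + 2) b c)"
    (is "?E * _ = ?\<kappa> * _")
proof -
  have B2: "1 + (a + 2) - b \<notin> \<int>\<^sub>\<le>\<^sub>0" and C2: "1 + (a + 2) - c \<notin> \<int>\<^sub>\<le>\<^sub>0"
    using nonpos_Int_shift[OF B, of 2] nonpos_Int_shift[OF C, of 2] by (simp_all add: algebra_simps)
  have conv2: "Re (1 + (a + 2) / 2 - b - c) > 0" using conv by (simp add: add_divide_distrib)
  have s: "summable (dixon_term a b c)" "summable (dixon_term (a + 2) b c)"
    using summable_norm_cancel[OF summable_dixon_term[OF B C conv]]
      summable_norm_cancel[OF summable_dixon_term[OF B2 C2 conv2]] by auto
  let ?d = "\<lambda>n. ?E * dixon_term a b c n - ?\<kappa> * dixon_term (a + 2) b c n"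
  have part: "(\<Sum>n<Suc m. ?d n) = dixon_cert a b c m" for m
    by (induction m) (simp_all only: sum.lessThan_Suc dixon_cert_telescopes[OF B C], simp_all)
  have "?d sums 0"
    unfolding sums_def by (rule LIMSEQ_imp_Suc) (use part dixon_cert_tendsto_0[OF B C conv] in simp)
  moreover have "?d sums (?E * suminf (dixon_term a b c) - ?\<kappa> * suminf (dixon_term (a + 2) b c))"
    by (intro sums_diff sums_mult summable_sums s)
  ultimately show ?thesis using sums_unique2 by fastforce
qed

lemma Re_pos_not_nonpos_Int: "Re z > 0 \<Longrightarrow> z \<notin> \<int>\<^sub>\<le>\<^sub>0"
  by (auto elim!: nonpos_Ints_cases)

lemma dixon_value_shift:
  assumes B: "1 + a - b \<notin> \<int>\<^sub>\<le>\<^sub>0" and C: "1 + a - c \<notin> \<int>\<^sub>\<le>\<^sub>0" and conv: "Re (1 + a / 2 - b - c) > 0"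
  shows "(2 + a - 2 * b - 2 * c) * dixon_value a b c =
      (a + 1) * (1 + a - b - c) * (1 + a - b - c + 1) * (2 + a - 2 * b) * (2 + a - 2 * c) /
        ((1 + a - b) * (1 + a - b + 1) * (1 + a - c) * (1 + a - c + 1)) * dixon_value (a + 2) b c"
proof -
  define B' C' F g where "B' = 1 + a - b" and "C' = 1 + a - c" and "F = 1 + a - b - c" and "g = 1 + a / 2 - b - c"
  have nz: "B' \<noteq> 0" "B' + 1 \<noteq> 0" "C' \<noteq> 0" "C' + 1 \<noteq> 0" "g \<noteq> 0"
    using not_nonpos_Int_add_nat[OF B, of 0] not_nonpos_Int_add_nat[OF B, of 1]
      not_nonpos_Int_add_nat[OF C, of 0] not_nonpos_Int_add_nat[OF C, of 1] conv
    by (auto simp: B'_def C'_def g_def)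
  have plus2: "Gamma (z + 2) = z * (z + 1) * Gamma z" if "z \<notin> \<int>\<^sub>\<le>\<^sub>0" for z :: complex
    using Gamma_plus1[of z] Gamma_plus1[of "z + 1"] nonpos_Int_shift[of z 1] that by (simp add: add_ac mult_ac)
  have BC: "B' \<notin> \<int>\<^sub>\<le>\<^sub>0" "C' \<notin> \<int>\<^sub>\<le>\<^sub>0" "g \<notin> \<int>\<^sub>\<le>\<^sub>0"
    using B C Re_pos_not_nonpos_Int[OF conv] by (simp_all add: B'_def C'_def g_def)
  have args: "1 + (a + 2) - b = B' + 2" "1 + (a + 2) - c = C' + 2" "B' + 2 - c = F + 2"
      "1 + a / 2 - b + 1 - c = g + 1" "1 + (a + 2) / 2 - b = 1 + a / 2 - b + 1"
      "1 + (a + 2) / 2 - c = 1 + a / 2 - c + 1" "(1 + (a + 2)) / 2 = (1 + a) / 2 + 1"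
    by (simp_all add: B'_def C'_def F_def g_def field_simps)
  have ex: "exp (- (a + 2) * of_real (ln 2)) = exp (- a * of_real (ln 2)) / 4"
  proof -
    have "exp (of_real (ln 2)) = (2 :: complex)"
      by (metis exp_of_real exp_ln zero_less_numeral of_real_numeral)
    then have "exp (2 * of_real (ln 2)) = (4 :: complex)"
      by (simp add: exp_double)
    moreover have "- (a + 2) * of_real (ln 2) = - a * of_real (ln 2) - 2 * of_real (ln 2)"
      by (simp add: algebra_simps)
    ultimately show ?thesis by (simp only: exp_diff)
  qed
  \<comment> \<open>The Gamma factors are taken at \<open>a\<close> and the reciprocal ones at
    \<open>a + 2\<close>, so both values are \<open>R\<close> times a polynomial.\<close>
  define R where "R = of_real (sqrt pi) * exp (- a * of_real (ln 2)) * rGamma ((1 + a) / 2 + 1) *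
     Gamma g * Gamma B' * Gamma C' * rGamma (F + 2) * rGamma (1 + a / 2 - b + 1) * rGamma (1 + a / 2 - c + 1)"
  have r1: "rGamma ((1 + a) / 2) = (1 + a) / 2 * rGamma ((1 + a) / 2 + 1)"
    by (rule rGamma_plus1[symmetric])
  have r2: "rGamma (B' - c) = F * (F + 1) * rGamma (F + 2)"
    using rGamma_plus1[of F] rGamma_plus1[of "F + 1"] by (simp add: B'_def F_def add_ac mult_ac)
  have v1: "dixon_value a b c = R * ((1 + a) / 2 * (F * (F + 1)) * (1 + a / 2 - b) * (1 + a / 2 - c))"
    unfolding dixon_value_def R_def B'_def[symmetric] C'_def[symmetric] F_def[symmetric] g_def[symmetric]
      r1 r2 rGamma_plus1[of "1 + a / 2 - b", symmetric] rGamma_plus1[of "1 + a / 2 - c", symmetric]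
    by (simp only: mult_ac)
  have v2: "dixon_value (a + 2) b c = R * (g * (B' * (B' + 1)) * (C' * (C' + 1)) / 4)"
    unfolding dixon_value_def R_def args ex plus2[OF BC(1)] plus2[OF BC(2)] Gamma_plus1[OF BC(3)]
    by simp
  have args': "2 + a - 2 * b - 2 * c = 2 * g" "2 + a - 2 * b = 2 * (1 + a / 2 - b)"
      "2 + a - 2 * c = 2 * (1 + a / 2 - c)" "1 + a - b - c = F" "1 + a - b = B'" "1 + a - c = C'"
    by (simp_all add: B'_def C'_def F_def g_def)
  have cancel: "X / (x * (x + 1) * y * (y + 1)) * (R * (g * (x * (x + 1)) * (y * (y + 1)) / 4)) = X * R * g / 4"
    if "x \<noteq> 0" "x + 1 \<noteq> 0" "y \<noteq> 0" "y + 1 \<noteq> 0" for X x y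
    using that by simp
  show ?thesis
    unfolding v1 v2 args'(1,4) unfolding args'(5,6) cancel[OF nz(1-4)]
    by (simp add: field_simps)
qed

section \<open>Limits as the first parameter tends to infinity\<close>

lemma norm_pochhammer_le:
  assumes "norm (z :: complex) \<le> r"
  shows "norm (pochhammer z n) \<le> pochhammer r n"
proof (induction n)
  case (Suc n)
  have "norm (z + of_nat n) \<le> r + of_nat n"
    using norm_triangle_ineq[of z "of_nat n"] assms by simp
  moreover have "0 \<le> r" using assms norm_ge_zero[of z] by linarith
  ultimately show ?case
    using Suc by (simp add: pochhammer_Suc norm_mult mult_mono order_trans[OF norm_ge_zero])
qed simp

text \<open>Each factor of the quotient is at most 1 + d/|z+n|, hence at most 1 + d/(r+n). The bound
  is uniform in \<open>z\<close>, as a majorant requires.\<close>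

lemma norm_pochhammer_ratio_le:
  assumes "Re z \<ge> r" "r > 0" "norm (w - z) \<le> d"
  shows "norm (pochhammer w n) / norm (pochhammer z n) \<le> pochhammer (r + d) n / pochhammer r n"
proof (induction n)
  case (Suc n)
  have z: "norm (z + of_nat n) \<ge> r + of_nat n"
    using complex_Re_le_cmod[of "z + of_nat n"] assms(1) by simp
  have pos: "r + of_nat n > 0" using assms(2) by simp
  have d: "d \<ge> 0" using assms(3) norm_ge_zero order_trans by blast
  have "norm (w + of_nat n) \<le> norm (z + of_nat n) + d"
    using norm_triangle_ineq[of "z + of_nat n" "w - z"] assms(3) by (simp add: add.commute)
  then have "norm (w + of_nat n) / norm (z + of_nat n) \<le> (norm (z + of_nat n) + d) / norm (z + of_nat n)"
    by (rule divide_right_mono) simp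
  also have "\<dots> = 1 + d / norm (z + of_nat n)"
  proof -
    have "norm (z + of_nat n) \<noteq> 0" using z pos by linarith
    then show ?thesis by (simp add: add_divide_distrib)
  qed
  also have "\<dots> \<le> 1 + d / (r + of_nat n)"
    using z pos d by (simp add: frac_le)
  also have "\<dots> = (r + d + of_nat n) / (r + of_nat n)"
    using pos by (simp add: field_simps)
  finally have "norm (w + of_nat n) / norm (z + of_nat n) \<le> (r + d + of_nat n) / (r + of_nat n)" .
  then have "norm (pochhammer w n) / norm (pochhammer z n) * (norm (w + of_nat n) / norm (z + of_nat n)) \<le>
      pochhammer (r + d) n / pochhammer r n * ((r + d + of_nat n) / (r + of_nat n))"
    using assms(2) d by (intro mult_mono Suc) (auto intro!: divide_nonneg_nonneg pochhammer_nonneg)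
  then show ?case by (simp add: pochhammer_Suc norm_mult)
qed simp

text \<open>The factors are grouped by their behaviour for large \<open>a\<close>: the first tends
  to 1, the second is independent of \<open>a\<close>, the third tends to 0.\<close>

lemma dixon_term_eq_prod:
  "dixon_term a b c n = (\<Prod>i<n. ((a + of_nat i) / (1 + a - b + of_nat i)) *
     ((b + of_nat i) * (c + of_nat i) / (1 + of_nat i)) * (1 / (1 + a - c + of_nat i)))"
proof (induction n)
  case (Suc n)
  have "dixon_term a b c (Suc n) = dixon_term a b c n * (((a + of_nat n) / (1 + a - b + of_nat n)) *
     ((b + of_nat n) * (c + of_nat n) / (1 + of_nat n)) * (1 / (1 + a - c + of_nat n)))"
    unfolding dixon_term_def pochhammer_Suc fact_Suc of_nat_Suc
    by (simp only: divide_inverse inverse_mult_distrib mult_ac mult_1_left)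
  then show ?case using Suc by simp
qed (simp add: dixon_term_def)

lemma filterlim_add_double_at_infinity:
  "filterlim (\<lambda>m. z + 2 * of_nat m :: complex) at_infinity sequentially"
proof -
  have "filterlim (\<lambda>m. of_nat m :: complex) at_infinity sequentially"
    by (rule tendsto_of_nat)
  then have "filterlim (\<lambda>m. 2 * of_nat m :: complex) at_infinity sequentially"
    by (intro tendsto_mult_filterlim_at_infinity[OF tendsto_const]) simp_all
  then show ?thesis
    by (intro tendsto_add_filterlim_at_infinity[OF tendsto_const])
qed

lemma dixon_term_tendsto:
  "(\<lambda>m. dixon_term (a + 2 * of_nat m) b c n) \<longlonglongrightarrow> (if n = 0 then 1 else 0)"
proof -
  have inv: "(\<lambda>m. x / (z + 2 * of_nat m)) \<longlonglongrightarrow> 0" for x z :: complex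
    by (rule tendsto_divide_0[OF tendsto_const filterlim_add_double_at_infinity])
  have one: "(\<lambda>m. (a + 2 * of_nat m + of_nat i) / (1 + (a + 2 * of_nat m) - b + of_nat i)) \<longlonglongrightarrow> 1" for i
  proof -
    let ?z = "1 + a - b + of_nat i"
    have "eventually (\<lambda>m. ?z + 2 * of_nat m \<noteq> 0) sequentially"
      using filterlim_at_infinity_imp_eventually_ne[OF filterlim_add_double_at_infinity] .
    then have "eventually (\<lambda>m. 1 + (b - 1) / (?z + 2 * of_nat m) =
        (a + 2 * of_nat m + of_nat i) / (1 + (a + 2 * of_nat m) - b + of_nat i)) sequentially"
      by eventually_elim (simp add: field_simps)
    moreover have "(\<lambda>m. 1 + (b - 1) / (?z + 2 * of_nat m)) \<longlonglongrightarrow> 1 + 0"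
      by (intro tendsto_add tendsto_const inv)
    ultimately show ?thesis using Lim_transform_eventually by fastforce
  qed
  have zero: "(\<lambda>m. 1 / (1 + (a + 2 * of_nat m) - c + of_nat i)) \<longlonglongrightarrow> 0" for i
    using inv[of 1 "1 + a - c + of_nat i"] by (simp add: algebra_simps)
  have "(\<lambda>m. dixon_term (a + 2 * of_nat m) b c n) \<longlonglongrightarrow>
      (\<Prod>i<n. 1 * ((b + of_nat i) * (c + of_nat i) / (1 + of_nat i)) * 0)"
    unfolding dixon_term_eq_prod by (intro tendsto_prod tendsto_mult one zero tendsto_const)
  then show ?thesis by (auto simp: prod_constant power_0_left split: if_splits)
qed

lemma dixon_sum_tendsto: "(\<lambda>m. suminf (dixon_term (a + 2 * of_nat m) b c)) \<longlonglongrightarrow> 1"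
proof -
  \<comment> \<open>The norm of \<open>b - 1\<close> enters because it is the distance between the
    parameters \<open>a\<close> and \<open>1 + a - b\<close>. The choice
    \<open>M = 3 * r + 1\<close> gives the majorant \<open>bd\<close> order -2.\<close>
  define r where "r = norm b + norm c + norm (b - 1) + 1"
  define M where "M = 3 * r + 1"
  define bd where "bd n = pochhammer (M + r) n * pochhammer r n * pochhammer r n /
     (fact n * pochhammer M n * pochhammer M n)" for n
  have r: "r > 0" "norm b \<le> r" "norm c \<le> r" "norm (b - 1) \<le> r"
    using norm_ge_zero[of b] norm_ge_zero[of c] norm_ge_zero[of "b - 1"]
    unfolding r_def by linarith+
  then have M: "M > 0" by (simp add: M_def)
  have "summable bd"
  proof -
    \<comment> \<open>This value makes both lower parameters \<open>1 + ?a - r\<close> equal to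
      \<open>M\<close>, while the upper parameter \<open>M + r\<close> takes the role of
      \<open>d\<close>.\<close>
    let ?a = "of_real (M + r - 1) :: complex"
    have Mn: "1 + ?a - of_real r \<notin> \<int>\<^sub>\<le>\<^sub>0"
      using M by (auto elim!: nonpos_Ints_cases simp: complex_eq_iff)
    have "summable (\<lambda>n. norm (pochhammer (of_real (M + r)) n * pochhammer (of_real r) n * pochhammer (of_real r) n /
       (fact n * pochhammer (1 + ?a - of_real r) n * pochhammer (1 + ?a - of_real r) n) :: complex))"
      by (rule order_le_summable[OF order_le_well_poised[OF Mn Mn]]) (use r in \<open>simp add: M_def\<close>)
    moreover have "1 + ?a - of_real r = of_real M" by simp
    moreover have "norm (pochhammer (of_real (M + r)) n * pochhammer (of_real r) n * pochhammer (of_real r) n /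
       (fact n * pochhammer (of_real M) n * pochhammer (of_real M) n) :: complex) = bd n" for n
    proof -
      have "pochhammer x n \<ge> 0" if "x > 0" for x :: real using that by (rule pochhammer_nonneg)
      then have "bd n \<ge> 0" unfolding bd_def using r M by (intro divide_nonneg_nonneg mult_nonneg_nonneg) auto
      moreover have "(pochhammer (of_real (M + r)) n * pochhammer (of_real r) n * pochhammer (of_real r) n /
       (fact n * pochhammer (of_real M) n * pochhammer (of_real M) n) :: complex) = of_real (bd n)"
        unfolding bd_def pochhammer_of_real by simp
      ultimately show ?thesis by simp
    qed
    ultimately show ?thesis by simp
  qed
  moreover have "eventually (\<lambda>(n, m). norm (dixon_term (a + 2 * of_nat m) b c n) \<le> bd n) (at_top \<times>\<^sub>F sequentially)"
  proof -
    have "eventually (\<lambda>m. \<forall>n. norm (dixon_term (a + 2 * of_nat m) b c n) \<le> bd n) sequentially"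
      using eventually_ge_at_top[of "nat \<lceil>M + norm a + norm b + norm c\<rceil>"]
    proof eventually_elim
      case (elim m)
      let ?A = "a + 2 * of_nat m"
      have m: "real m \<ge> M + norm a + norm b + norm c" using elim by linarith
      have Re: "\<bar>Re a\<bar> \<le> norm a" "\<bar>Re b\<bar> \<le> norm b" "\<bar>Re c\<bar> \<le> norm c" by (rule abs_Re_le_cmod)+
      have RB: "Re (1 + ?A - b) \<ge> M" and RC: "Re (1 + ?A - c) \<ge> M"
        using Re m by simp_all
      show ?case
      proof
        fix n
        have pr: "pochhammer r n \<ge> 0" using r by (intro pochhammer_nonneg) simp
        have 1: "norm (pochhammer ?A n) / norm (pochhammer (1 + ?A - b) n) \<le> pochhammer (M + r) n / pochhammer M n"
          by (rule norm_pochhammer_ratio_le[OF RB M]) (use r(4) in simp)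
        have 2: "norm (pochhammer c n) / norm (pochhammer (1 + ?A - c) n) \<le> pochhammer r n / pochhammer M n"
        proof (rule frac_le)
          show "pochhammer M n \<le> norm (pochhammer (1 + ?A - c) n)"
          proof -
            have "pochhammer M k \<le> norm (pochhammer (1 + ?A - c) k)" for k
            proof (induction k)
              case (Suc k)
              have "M + of_nat k \<le> norm (1 + ?A - c + of_nat k)"
                using complex_Re_le_cmod[of "1 + ?A - c + of_nat k"] RC by simp
              then show ?case using Suc M by (simp add: pochhammer_Suc norm_mult mult_mono)
            qed simp
            then show ?thesis .
          qed
        qed (use pr M r norm_pochhammer_le[of c r] in \<open>auto intro: pochhammer_pos\<close>)
        have 3: "norm (pochhammer b n) / fact n \<le> pochhammer r n / fact n"
          using norm_pochhammer_le[OF r(2)] by (simp add: divide_right_mono)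
        have "norm (dixon_term ?A b c n) = (norm (pochhammer ?A n) / norm (pochhammer (1 + ?A - b) n)) *
            (norm (pochhammer c n) / norm (pochhammer (1 + ?A - c) n)) * (norm (pochhammer b n) / fact n)"
          by (simp add: dixon_term_def norm_mult norm_divide mult_ac)
        also have "\<dots> \<le> (pochhammer (M + r) n / pochhammer M n) * (pochhammer r n / pochhammer M n) * (pochhammer r n / fact n)"
          using pr M r by (intro mult_mono 1 2 3) (auto intro!: mult_nonneg_nonneg divide_nonneg_nonneg pochhammer_nonneg)
        also have "\<dots> = bd n" by (simp add: bd_def)
        finally show "norm (dixon_term ?A b c n) \<le> bd n" .
      qed
    qed
    then have "eventually (\<lambda>(k :: nat, m). \<forall>n. norm (dixon_term (a + 2 * of_nat m) b c n) \<le> bd n) (at_top \<times>\<^sub>F sequentially)"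
      by (subst eventually_prod2) auto
    then show ?thesis by (rule eventually_mono) auto
  qed
  ultimately have "(\<lambda>m. \<Sum>n. dixon_term (a + 2 * of_nat m) b c n) \<longlonglongrightarrow> (\<Sum>n. if n = 0 then 1 else 0)"
    using tannerys_theorem[OF dixon_term_tendsto] by fastforce
  moreover have "(\<Sum>n. if n = 0 then 1 else 0 :: complex) = 1"
    using sums_single[of 0 "\<lambda>_. 1 :: complex"] sums_unique by fastforce
  ultimately show ?thesis by simp
qed


text \<open>This is Gauss' limit formula for the reciprocal Gamma function, multiplied by
  \<open>Gamma z\<close>.\<close>

lemma Gamma_add_nat_ratio_tendsto:
  assumes "z \<notin> \<int>\<^sub>\<le>\<^sub>0"
  shows "(\<lambda>n. Gamma (z + 1 + of_nat n) / (fact n * exp (z * of_real (ln (real n))))) \<longlonglongrightarrow> (1 :: complex)"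
proof -
  have nz: "Gamma z \<noteq> 0" using assms by (simp add: Gamma_eq_zero_iff)
  have "(\<lambda>n. Gamma z * rGamma_series z n) \<longlonglongrightarrow> Gamma z * rGamma z"
    by (intro tendsto_mult tendsto_const rGamma_series_LIMSEQ)
  moreover have "Gamma z * rGamma z = 1" using nz by (simp add: rGamma_inverse_Gamma)
  moreover have "Gamma z * rGamma_series z n = Gamma (z + 1 + of_nat n) / (fact n * exp (z * of_real (ln (real n))))" for n
    using pochhammer_Gamma[OF assms, of "Suc n"] nz by (simp add: rGamma_series_def add_ac)
  ultimately show ?thesis by simp
qed

text \<open>For \<open>Re a > 0\<close> the duplication formula restores the classical form, to
  which Gamma asymptotics apply factor by factor.\<close>

lemma dixon_value_eq_Gamma_quotient:
  assumes "Re a > 0"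
  shows "dixon_value a b c = Gamma (1 + a / 2) / Gamma (1 + a) *
     Gamma (1 + a / 2 - b - c) * Gamma (1 + a - b) * Gamma (1 + a - c) *
     rGamma (1 + a - b - c) * rGamma (1 + a / 2 - b) * rGamma (1 + a / 2 - c)"
proof -
  have n: "(1 + a) / 2 \<notin> \<int>\<^sub>\<le>\<^sub>0" "(1 + a) / 2 + 1 / 2 \<notin> \<int>\<^sub>\<le>\<^sub>0" "1 + a \<notin> \<int>\<^sub>\<le>\<^sub>0"
    by (rule Re_pos_not_nonpos_Int, use assms in \<open>simp add: field_simps\<close>)+
  have args: "(1 + a) / 2 + 1 / 2 = 1 + a / 2" "2 * ((1 + a) / 2) = 1 + a" "1 - (1 + a) = - a"
    by (simp_all add: field_simps)
  have "Gamma ((1 + a) / 2) * Gamma (1 + a / 2) =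
      exp (- a * of_real (ln 2)) * of_real (sqrt pi) * Gamma (1 + a)"
    using Gamma_legendre_duplication[OF n(1,2)] by (simp only: args)
  then have "of_real (sqrt pi) * exp (- a * of_real (ln 2)) * rGamma ((1 + a) / 2) = Gamma (1 + a / 2) / Gamma (1 + a)"
    using n by (simp add: rGamma_inverse_Gamma Gamma_eq_zero_iff field_simps)
  then show ?thesis unfolding dixon_value_def by simp
qed

text \<open>Every Gamma factor is normalized by its asymptotics, at \<open>m\<close> for arguments
  containing \<open>a / 2\<close> and at \<open>2 * m\<close> for those containing \<open>a\<close>.
  The factorials and the powers of m and of 2m then cancel separately.\<close>

lemma dixon_value_tendsto:
  assumes "Re a > 0" "Re (a / 2 - b) > 0" "Re (a / 2 - c) > 0" "Re (a / 2 - b - c) > 0"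
  shows "(\<lambda>m. dixon_value (a + 2 * of_nat m) b c) \<longlonglongrightarrow> 1"
proof -
  define g where "g z n = Gamma (z + 1 + of_nat n) / (fact n * exp (z * of_real (ln (real n))))" for z :: complex and n
  have lim1: "(\<lambda>m. g z m) \<longlonglongrightarrow> 1" if "Re z > 0" for z
    unfolding g_def by (intro Gamma_add_nat_ratio_tendsto Re_pos_not_nonpos_Int that)
  have lim2: "(\<lambda>m. g z (2 * m)) \<longlonglongrightarrow> 1" if "Re z > 0" for z
    by (rule filterlim_compose[OF lim1[OF that]])
       (intro filterlim_subseq, simp add: strict_mono_def)
  have pos: "Re (a - b) > 0" "Re (a - c) > 0" "Re (a - b - c) > 0" "Re (a / 2) > 0"
    using assms by auto
  have "(\<lambda>m. (g (a / 2) m / g a (2 * m)) * g (a / 2 - b - c) m * g (a - b) (2 * m) * g (a - c) (2 * m) /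
      (g (a - b - c) (2 * m) * g (a / 2 - b) m * g (a / 2 - c) m)) \<longlonglongrightarrow> (1 / 1) * 1 * 1 * 1 / (1 * 1 * 1)"
    using assms pos by (intro tendsto_divide tendsto_mult lim1 lim2) auto
  moreover have "(g (a / 2) m / g a (2 * m)) * g (a / 2 - b - c) m * g (a - b) (2 * m) * g (a - c) (2 * m) /
      (g (a - b - c) (2 * m) * g (a / 2 - b) m * g (a / 2 - c) m) = dixon_value (a + 2 * of_nat m) b c" for m
  proof -
    define e where "e z n = exp (z * complex_of_real (ln (real n)))" for z n
    define G where "G z n = Gamma (z + 1 + complex_of_nat n)" for z n
    have gG: "g z n = G z n / (fact n * e z n)" for z n by (simp add: g_def G_def e_def)
    have e1: "e (a / 2) m * e (a / 2 - b - c) m = e (a / 2 - b) m * e (a / 2 - c) m"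
      unfolding e_def exp_add[symmetric] by (simp add: algebra_simps)
    have e2: "e (a - b) (2 * m) * e (a - c) (2 * m) = e a (2 * m) * e (a - b - c) (2 * m)"
      unfolding e_def exp_add[symmetric] by (simp add: algebra_simps)
    have enz: "e z n \<noteq> 0" for z n by (simp add: e_def)
    have Gnz: "G z n \<noteq> 0" if "Re z > 0" for z n
      unfolding G_def Gamma_eq_zero_iff using that by (intro Re_pos_not_nonpos_Int) simp
    have cancel: "x1 / (p * y1) / (x2 / (q * y2)) * (x3 / (p * y3)) * (x4 / (q * y4)) * (x5 / (q * y5)) /
        (x6 / (q * y6) * (x7 / (p * y7)) * (x8 / (p * y8))) = x1 / x2 * x3 * x4 * x5 / (x6 * x7 * x8)"
      if "y1 * y3 = y7 * y8" "y4 * y5 = y2 * y6" "x2 \<noteq> 0" "x6 \<noteq> 0" "x7 \<noteq> 0" "x8 \<noteq> 0" "p \<noteq> 0" "q \<noteq> 0"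
        "y1 \<noteq> 0" "y2 \<noteq> 0" "y3 \<noteq> 0" "y4 \<noteq> 0" "y5 \<noteq> 0" "y6 \<noteq> 0" "y7 \<noteq> 0" "y8 \<noteq> 0"
      for x1 x2 x3 x4 x5 x6 x7 x8 y1 y2 y3 y4 y5 y6 y7 y8 p q :: complex
    proof -
      have "x1 / (p * y1) / (x2 / (q * y2)) * (x3 / (p * y3)) * (x4 / (q * y4)) * (x5 / (q * y5)) /
          (x6 / (q * y6) * (x7 / (p * y7)) * (x8 / (p * y8))) =
          x1 / x2 * x3 * x4 * x5 / (x6 * x7 * x8) * (((y7 * y8) * (y2 * y6)) / ((y1 * y3) * (y4 * y5)))"
        using that(3-) by (simp add: divide_simps)
      then show ?thesis using that by simp
    qed
    have "(g (a / 2) m / g a (2 * m)) * g (a / 2 - b - c) m * g (a - b) (2 * m) * g (a - c) (2 * m) /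
      (g (a - b - c) (2 * m) * g (a / 2 - b) m * g (a / 2 - c) m) =
      (G (a / 2) m / G a (2 * m)) * G (a / 2 - b - c) m * G (a - b) (2 * m) * G (a - c) (2 * m) /
      (G (a - b - c) (2 * m) * G (a / 2 - b) m * G (a / 2 - c) m)"
      unfolding gG by (rule cancel[OF e1 e2]) (use enz Gnz assms pos in simp_all)
    also have "\<dots> = dixon_value (a + 2 * of_nat m) b c"
    proof -
      let ?A = "a + 2 * of_nat m"
      have A: "Re ?A > 0" using assms(1) by (simp add: add_pos_nonneg)
      have G: "G (a / 2) m = Gamma (1 + ?A / 2)" "G a (2 * m) = Gamma (1 + ?A)"
        "G (a / 2 - b - c) m = Gamma (1 + ?A / 2 - b - c)" "G (a - b) (2 * m) = Gamma (1 + ?A - b)"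
        "G (a - c) (2 * m) = Gamma (1 + ?A - c)" "G (a - b - c) (2 * m) = Gamma (1 + ?A - b - c)"
        "G (a / 2 - b) m = Gamma (1 + ?A / 2 - b)" "G (a / 2 - c) m = Gamma (1 + ?A / 2 - c)"
        by (simp_all add: G_def add_divide_distrib algebra_simps)
      show ?thesis
        unfolding G dixon_value_eq_Gamma_quotient[OF A] rGamma_inverse_Gamma
        by (simp only: divide_inverse inverse_mult_distrib mult_ac)
    qed
    finally show ?thesis .
  qed
  ultimately show ?thesis by simp
qed

theorem dixon:
  assumes "1 + a - b \<notin> \<int>\<^sub>\<le>\<^sub>0" "1 + a - c \<notin> \<int>\<^sub>\<le>\<^sub>0" "Re (1 + a / 2 - b - c) > 0"
  shows "suminf (dixon_term a b c) = dixon_value a b c"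
proof -
  let ?a = "\<lambda>m. a + 2 * of_nat m"
  have B: "1 + ?a m - b \<notin> \<int>\<^sub>\<le>\<^sub>0" and C: "1 + ?a m - c \<notin> \<int>\<^sub>\<le>\<^sub>0" and R: "Re (1 + ?a m / 2 - b - c) > 0" for m
  proof -
    show "1 + ?a m - b \<notin> \<int>\<^sub>\<le>\<^sub>0" "1 + ?a m - c \<notin> \<int>\<^sub>\<le>\<^sub>0"
      using nonpos_Int_shift[OF assms(1), of "2 * m"] nonpos_Int_shift[OF assms(2), of "2 * m"]
      by (simp_all add: algebra_simps)
    show "Re (1 + ?a m / 2 - b - c) > 0" using assms(3) by (simp add: add_divide_distrib)
  qed
  define \<rho> where "\<rho> x = (x + 1) * (1 + x - b - c) * (1 + x - b - c + 1) * (2 + x - 2 * b) * (2 + x - 2 * c) /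
        ((1 + x - b) * (1 + x - b + 1) * (1 + x - c) * (1 + x - c + 1)) / (2 + x - 2 * b - 2 * c)" for x
  have nz: "2 + ?a m - 2 * b - 2 * c \<noteq> 0" for m
  proof
    assume "2 + ?a m - 2 * b - 2 * c = 0"
    then have "1 + ?a m / 2 - b - c = 0" by (simp add: field_simps)
    with R[of m] show False by simp
  qed
  have Suc: "?a (Suc m) = ?a m + 2" for m by simp
  have solve: "y = k / E * z" if "E * y = k * z" "E \<noteq> 0" for y z k E :: complex
    using that by (simp add: field_simps)
  have S: "suminf (dixon_term (?a m) b c) = \<rho> (?a m) * suminf (dixon_term (?a (Suc m)) b c)" for m
    unfolding Suc \<rho>_def by (rule solve[OF dixon_sum_shift[OF B C R] nz])
  have V: "dixon_value (?a m) b c = \<rho> (?a m) * dixon_value (?a (Suc m)) b c" for m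
    unfolding Suc \<rho>_def by (rule solve[OF dixon_value_shift[OF B C R] nz])
  have SP: "suminf (dixon_term (?a 0) b c) = (\<Prod>i<m. \<rho> (?a i)) * suminf (dixon_term (?a m) b c)" for m
  proof (induction m)
    case (Suc m) then show ?case using S[of m] by simp
  qed simp
  have VP: "dixon_value (?a 0) b c = (\<Prod>i<m. \<rho> (?a i)) * dixon_value (?a m) b c" for m
  proof (induction m)
    case (Suc m) then show ?case using V[of m] by simp
  qed simp
  \<comment> \<open>Cross-multiplication avoids division by the product of the
    \<open>\<rho>\<close>, which may vanish.\<close>
  have eq: "suminf (dixon_term a b c) * dixon_value (?a m) b c = dixon_value a b c * suminf (dixon_term (?a m) b c)" for m
    using SP[of m] VP[of m] by simp
  \<comment> \<open>A preliminary shift by \<open>2 * k\<close> makes the four real parts required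
    for the limit of \<open>dixon_value\<close> positive.\<close>
  obtain k where k: "real k > norm a + 2 * norm b + 2 * norm c" using reals_Archimedean2 by blast
  have Re: "\<bar>Re a\<bar> \<le> norm a" "\<bar>Re b\<bar> \<le> norm b" "\<bar>Re c\<bar> \<le> norm c" by (rule abs_Re_le_cmod)+
  have "(\<lambda>m. dixon_value (?a k + 2 * of_nat m) b c) \<longlonglongrightarrow> 1"
    by (rule dixon_value_tendsto) (use Re k norm_ge_zero[of a] norm_ge_zero[of b] norm_ge_zero[of c] in \<open>simp_all add: field_simps\<close>)
  then have "(\<lambda>m. dixon_value (?a (m + k)) b c) \<longlonglongrightarrow> 1"
    by (simp add: algebra_simps)
  then have "(\<lambda>m. dixon_value (?a m) b c) \<longlonglongrightarrow> 1"
    by (rule LIMSEQ_offset)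
  then have "(\<lambda>m. suminf (dixon_term a b c) * dixon_value (?a m) b c) \<longlonglongrightarrow> suminf (dixon_term a b c) * 1"
    by (intro tendsto_mult tendsto_const)
  moreover have "(\<lambda>m. dixon_value a b c * suminf (dixon_term (?a m) b c)) \<longlonglongrightarrow> dixon_value a b c * 1"
    by (intro tendsto_mult tendsto_const dixon_sum_tendsto)
  ultimately have "suminf (dixon_term a b c) * 1 = dixon_value a b c * 1"
    unfolding eq by (rule LIMSEQ_unique)
  then show ?thesis by simp
qed

section \<open>The coefficients of the root system \<open>A\<^sub>2\<close>\<close>

text \<open>Extension by 0 to negative indices removes the boundary conditions from index
  shifts.\<close>

definition binom_ext :: "complex \<Rightarrow> int \<Rightarrow> complex" where
  "binom_ext u k = (if k < 0 then 0 else binom_coeff u (nat k))"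

lemma binom_ext_neg: "k < 0 \<Longrightarrow> binom_ext u k = 0"
  by (simp add: binom_ext_def)

lemma binom_ext_of_nat: "binom_ext u (int n) = binom_coeff u n"
  by (simp add: binom_ext_def)

lemma binom_coeff_eq_pochhammer: "binom_coeff u n = pochhammer (- u) n / fact n"
  by (simp add: binom_coeff_def gbinomial_pochhammer flip: power_mult_distrib)

lemma binom_coeff_Suc: "of_nat (Suc n) * binom_coeff u (Suc n) = (of_nat n - u) * binom_coeff u n"
  by (simp add: binom_coeff_eq_pochhammer pochhammer_Suc divide_simps del: of_nat_Suc)

text \<open>At \<open>k = -1\<close> the left factor \<open>k + 1\<close> vanishes, so the
  recurrence is consistent with the extension by 0.\<close>

lemma binom_ext_rec: "of_int (k + 1) * binom_ext u (k + 1) = (of_int k - u) * binom_ext u k"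
proof (cases "k < 0")
  case True
  then show ?thesis by (cases "k = -1") (simp_all add: binom_ext_neg)
next
  case False
  then obtain n where k: "k = int n" by (metis nonneg_int_cases not_less)
  have "k + 1 = int (Suc n)" using k by simp
  then show ?thesis
    using binom_coeff_Suc[of n u] by (simp only: k binom_ext_of_nat of_int_of_nat_eq)
qed

lemma order_le_binom_ext: "order_le (\<lambda>n. binom_ext u (int n + i)) (- 1 - Re u)"
proof -
  have exponent: "- 1 - Re u = Re (- u) - 1" by simp
  have "order_le (\<lambda>n. binom_coeff u n) (- 1 - Re u)"
    unfolding exponent binom_coeff_eq_pochhammer by (rule order_le_pochhammer_over_fact)
  then have "order_le (\<lambda>n. binom_coeff u (nat (int n + i))) (- 1 - Re u)"
    by (rule order_le_compose_shift)
  moreover have "eventually (\<lambda>n. norm (binom_ext u (int n + i)) = norm (binom_coeff u (nat (int n + i)))) sequentially"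
    using eventually_ge_at_top[of "nat \<bar>i\<bar>"] by eventually_elim (auto simp: binom_ext_def)
  ultimately show ?thesis
    unfolding order_le_def by (simp add: landau_o.big.in_cong)
qed

text \<open>The two partial sums differ by at most |i| nonzero terms, all near \<open>K\<close>;
  those near 0 vanish. Summability is not assumed, as the sequences concerned may only tend to
  0.\<close>

lemma sum_shift_tendsto_0:
  fixes f :: "int \<Rightarrow> complex"
  assumes neg: "\<And>k. k < 0 \<Longrightarrow> f k = 0" "\<And>k. k < 0 \<Longrightarrow> f (k + i) = 0"
    and lim: "\<And>j. (\<lambda>n. f (int n + j)) \<longlonglongrightarrow> 0"
  shows "(\<lambda>K. (\<Sum>n<K. f (int n + i)) - (\<Sum>n<K. f (int n))) \<longlonglongrightarrow> 0"
proof -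
  have nonneg: "(\<lambda>K. (\<Sum>n<K. f (int n + int d)) - (\<Sum>n<K. f (int n))) \<longlonglongrightarrow> 0"
    if neg': "\<And>k. k < 0 \<Longrightarrow> f (k + int d) = 0" and lim: "\<And>j. (\<lambda>n. f (int n + j)) \<longlonglongrightarrow> 0"
    for d and f :: "int \<Rightarrow> complex"
  proof -
    have "(\<Sum>n<K. f (int n + int d)) - (\<Sum>n<K. f (int n)) = (\<Sum>m<d. f (int K + int m))" for K
    proof -
      have "(\<Sum>n<d. f (int n)) = 0"
      proof (rule sum.neutral, rule ballI)
        fix n assume "n \<in> {..<d}"
        then show "f (int n) = 0" using neg'[of "int n - int d"] by simp
      qed
      then have "(\<Sum>n<d + K. f (int n)) = (\<Sum>n<K. f (int n + int d))"
        by (induction K) (simp_all add: add.commute)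
      moreover have "(\<Sum>n<K + d. f (int n)) = (\<Sum>n<K. f (int n)) + (\<Sum>m<d. f (int K + int m))"
        by (induction d) (simp_all add: add.assoc)
      ultimately show ?thesis by (simp add: algebra_simps)
    qed
    moreover have "(\<lambda>K. \<Sum>m<d. f (int K + int m)) \<longlonglongrightarrow> (\<Sum>m<d. 0)"
      by (intro tendsto_sum lim)
    ultimately show ?thesis by simp
  qed
  show ?thesis
  proof (cases "i \<ge> 0")
    case True
    then obtain d where d: "i = int d" by (metis nonneg_int_cases)
    show ?thesis unfolding d by (rule nonneg) (use neg(2) lim in \<open>simp_all add: d\<close>)
  next
    case False
    then obtain d where d: "i = - int d" by (metis nonneg_int_cases minus_minus neg_0_le_iff_le linear)
    \<comment> \<open>A negative shift is reversed: \<open>\<lambda>k. f (k + i)\<close> is shifted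
      forward by \<open>d\<close> to \<open>f\<close>.\<close>
    have "(\<lambda>K. (\<Sum>n<K. f (int n + int d + i)) - (\<Sum>n<K. f (int n + i))) \<longlonglongrightarrow> 0"
      by (rule nonneg[where f = "\<lambda>k. f (k + i)"])
         (use neg(1) lim in \<open>simp_all add: d add.assoc del: add_uminus_conv_diff\<close>)
    then have "(\<lambda>K. - ((\<Sum>n<K. f (int n + int d + i)) - (\<Sum>n<K. f (int n + i)))) \<longlonglongrightarrow> - 0"
      by (rule tendsto_minus)
    then show ?thesis by (simp add: d)
  qed
qed

text \<open>With \<open>F = \<Sum> c\<^sub>l c\<^sub>k c\<^sub>m (r/p)\<^sup>l (p/q)\<^sup>k (q/r)\<^sup>m\<close>, \<open>A2_coeff u \<alpha> \<beta> k\<close> is the summand of index \<open>k\<close>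
  in the coefficient of the inverse of \<open>p\<^sup>\<alpha> q\<^sup>\<beta> r\<^sup>\<gamma>\<close>, where \<open>\<alpha> + \<beta> + \<gamma> = 0\<close>.  \<open>sym_coeff\<close> belongs to
  \<open>S = F(p, q, r) + F(q, p, r)\<close> and \<open>anti_coeff\<close> to \<open>A = u (p + q)/(p - q) S\<close>.  The two halves of
  \<open>anti_coeff\<close> need not converge separately, which is why the difference is summed.\<close>

definition A2_coeff :: "complex \<Rightarrow> int \<Rightarrow> int \<Rightarrow> int \<Rightarrow> complex" where
  "A2_coeff u \<alpha> \<beta> k = binom_ext u k * binom_ext u (k + \<alpha>) * binom_ext u (k - \<beta>)"

definition sym_coeff :: "complex \<Rightarrow> int \<Rightarrow> int \<Rightarrow> complex" where
  "sym_coeff u \<alpha> \<beta> = (\<Sum>n. A2_coeff u \<alpha> \<beta> (int n) + A2_coeff u \<beta> \<alpha> (int n))"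

definition anti_term :: "complex \<Rightarrow> int \<Rightarrow> int \<Rightarrow> int \<Rightarrow> complex" where
  "anti_term u \<alpha> \<beta> k = (2 * of_int k - u) * (A2_coeff u \<alpha> \<beta> k - A2_coeff u \<beta> \<alpha> k)"

definition anti_coeff :: "complex \<Rightarrow> int \<Rightarrow> int \<Rightarrow> complex" where
  "anti_coeff u \<alpha> \<beta> = (\<Sum>n. anti_term u \<alpha> \<beta> (int n))"

lemma order_le_A2_coeff: "order_le (\<lambda>n. A2_coeff u \<alpha> \<beta> (int n + i)) (- 3 - 3 * Re u)"
proof -
  have "order_le (\<lambda>n. binom_ext u (int n + i) * binom_ext u (int n + (i + \<alpha>)) * binom_ext u (int n + (i - \<beta>)))
     ((- 1 - Re u) + (- 1 - Re u) + (- 1 - Re u))"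
    by (intro order_le_mult order_le_binom_ext)
  then show ?thesis by (simp add: A2_coeff_def add_ac add_diff_eq)
qed

text \<open>Each of the three binomial factors has order \<open>- 1 - Re u\<close>; the total is
  below -1 exactly if \<open>Re u > - 2 / 3\<close>.\<close>

lemma summable_norm_A2_coeff:
  assumes "Re u > - 2 / 3"
  shows "summable (\<lambda>n. norm (A2_coeff u \<alpha> \<beta> (int n)))"
  using order_le_summable[OF order_le_A2_coeff[of u \<alpha> \<beta> 0]] assms by simp

lemma summable_A2_coeff:
  assumes "Re u > - 2 / 3"
  shows "summable (\<lambda>n. A2_coeff u \<alpha> \<beta> (int n))"
  using summable_norm_A2_coeff[OF assms] by (rule summable_norm_cancel)

lemma sym_coeff_eq:
  assumes "Re u > - 2 / 3"
  shows "sym_coeff u \<alpha> \<beta> = (\<Sum>n. A2_coeff u \<alpha> \<beta> (int n)) + (\<Sum>n. A2_coeff u \<beta> \<alpha> (int n))"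
  unfolding sym_coeff_def by (rule suminf_add[symmetric]) (rule summable_A2_coeff[OF assms])+

lemma sym_coeff_commute: "sym_coeff u \<alpha> \<beta> = sym_coeff u \<beta> \<alpha>"
  by (simp add: sym_coeff_def add.commute)

text \<open>A linear factor leaves the order \<open>- 2 - 3 * Re u\<close>: negative, but in general
  too large for absolute summability. This is why telescoping sums are used below.\<close>

lemma tendsto_linear_A2_coeff:
  assumes "Re u > - 2 / 3"
  shows "(\<lambda>n. (x + of_int (int n + j) * y) * A2_coeff u \<alpha> \<beta> (int n + j)) \<longlonglongrightarrow> 0"
proof -
  have "order_le (\<lambda>n. ((x + of_int j * y) + of_nat n * y) * A2_coeff u \<alpha> \<beta> (int n + j)) (1 + (- 3 - 3 * Re u))"
    by (intro order_le_mult order_le_linear order_le_A2_coeff)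
  then have "(\<lambda>n. ((x + of_int j * y) + of_nat n * y) * A2_coeff u \<alpha> \<beta> (int n + j)) \<longlonglongrightarrow> 0"
    by (rule order_le_tendsto_0) (use assms in simp)
  then show ?thesis by (simp add: algebra_simps)
qed

lemma A2_coeff_neg: "k < 0 \<Longrightarrow> A2_coeff u \<alpha> \<beta> k = 0"
  by (simp add: A2_coeff_def binom_ext_neg)

text \<open>Invariance of \<open>F\<close> under the rotation of \<open>p, q, r\<close>.\<close>

lemma A2_coeff_rotate: "A2_coeff u \<alpha> \<beta> k = A2_coeff u (- \<alpha> - \<beta>) \<alpha> (k + \<alpha>)"
  by (simp add: A2_coeff_def algebra_simps)

text \<open>Coefficientwise form of \<open>(p - q) A = u (p + q) S\<close>, up to a telescoping difference.\<close>

lemma anti_term_shift: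
  "anti_term u (\<alpha> + 1) \<beta> k - anti_term u \<alpha> (\<beta> + 1) k =
     u * (A2_coeff u (\<alpha> + 1) \<beta> k + A2_coeff u \<beta> (\<alpha> + 1) k + A2_coeff u \<alpha> (\<beta> + 1) k + A2_coeff u (\<beta> + 1) \<alpha> k)
     - 2 * ((u - of_int k) * (A2_coeff u (\<alpha> + 1) \<beta> k + A2_coeff u (\<beta> + 1) \<alpha> k)
         - (u - of_int (k - 1)) * (A2_coeff u (\<alpha> + 1) \<beta> (k - 1) + A2_coeff u (\<beta> + 1) \<alpha> (k - 1)))"
proof -
  have rec: "(u - of_int (k - 1)) * binom_ext u (k - 1) = - of_int k * binom_ext u k"
    using binom_ext_rec[of "k - 1" u] by (simp add: algebra_simps)
  have "(u - of_int (k - 1)) * (A2_coeff u (\<alpha> + 1) \<beta> (k - 1) + A2_coeff u (\<beta> + 1) \<alpha> (k - 1)) =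
      ((u - of_int (k - 1)) * binom_ext u (k - 1)) *
      (binom_ext u (k + \<alpha>) * binom_ext u (k - (\<beta> + 1)) + binom_ext u (k + \<beta>) * binom_ext u (k - (\<alpha> + 1)))"
    by (simp add: A2_coeff_def algebra_simps)
  then have e: "(u - of_int (k - 1)) * (A2_coeff u (\<alpha> + 1) \<beta> (k - 1) + A2_coeff u (\<beta> + 1) \<alpha> (k - 1)) =
      (- of_int k * binom_ext u k) *
      (binom_ext u (k + \<alpha>) * binom_ext u (k - (\<beta> + 1)) + binom_ext u (k + \<beta>) * binom_ext u (k - (\<alpha> + 1)))"
    by (simp only: rec)
  show ?thesis
    unfolding e anti_term_def by (simp add: A2_coeff_def algebra_simps)
qed

text \<open>The difference \<open>U k - U (k - 1)\<close> sums to 0, because \<open>U\<close>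
  vanishes at -1 and tends to 0.\<close>

lemma anti_term_diff_sums:
  assumes "Re u > - 2 / 3"
  shows "(\<lambda>n. anti_term u (\<alpha> + 1) \<beta> (int n) - anti_term u \<alpha> (\<beta> + 1) (int n)) sums
     (u * (sym_coeff u (\<alpha> + 1) \<beta> + sym_coeff u \<alpha> (\<beta> + 1)))"
proof -
  define U where "U k = (u - of_int k) * (A2_coeff u (\<alpha> + 1) \<beta> k + A2_coeff u (\<beta> + 1) \<alpha> k)" for k
  define h where "h k = A2_coeff u (\<alpha> + 1) \<beta> k + A2_coeff u \<beta> (\<alpha> + 1) k + (A2_coeff u \<alpha> (\<beta> + 1) k + A2_coeff u (\<beta> + 1) \<alpha> k)" for k
  have termwise: "anti_term u (\<alpha> + 1) \<beta> k - anti_term u \<alpha> (\<beta> + 1) k = u * h k - 2 * (U k - U (k - 1))" for k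
    unfolding anti_term_shift U_def h_def by (simp add: add_ac)
  have "(\<lambda>n. h (int n)) sums (sym_coeff u (\<alpha> + 1) \<beta> + sym_coeff u \<alpha> (\<beta> + 1))"
    unfolding h_def sym_coeff_def by (intro sums_add summable_sums summable_add summable_A2_coeff assms)
  then have h: "(\<lambda>n. u * h (int n)) sums (u * (sym_coeff u (\<alpha> + 1) \<beta> + sym_coeff u \<alpha> (\<beta> + 1)))"
    by (rule sums_mult)
  have U: "(\<lambda>n. U (int n - 1)) \<longlonglongrightarrow> 0"
  proof -
    have "(\<lambda>n. (u + of_int (int n + (-1)) * (-1)) * A2_coeff u (\<alpha> + 1) \<beta> (int n + (-1)) +
        (u + of_int (int n + (-1)) * (-1)) * A2_coeff u (\<beta> + 1) \<alpha> (int n + (-1))) \<longlonglongrightarrow> 0 + 0"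
      by (intro tendsto_add tendsto_linear_A2_coeff assms)
    then show ?thesis by (simp add: U_def algebra_simps)
  qed
  have "(\<lambda>n. U (int (Suc n) - 1) - U (int n - 1)) sums (0 - U (int 0 - 1))"
    by (rule telescope_sums[OF U])
  then have "(\<lambda>n. U (int n) - U (int n - 1)) sums 0"
    by (simp add: U_def A2_coeff_neg)
  from sums_diff[OF h sums_mult[OF this, of 2]] show ?thesis
    unfolding termwise by simp
qed

lemma anti_term_swap: "anti_term u \<beta> \<alpha> k = - anti_term u \<alpha> \<beta> k"
  by (simp add: anti_term_def algebra_simps)

text \<open>Induction on \<open>\<alpha> - \<beta>\<close> in steps of 2: moving one unit from
  \<open>\<beta>\<close> to \<open>\<alpha>\<close> changes the term by a summable one. For
  difference 0 the term is 0; for difference 1 antisymmetry makes the change twice the term.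
  Negative differences follow by antisymmetry.\<close>

lemma summable_anti_term:
  assumes "Re u > - 2 / 3"
  shows "summable (\<lambda>n. anti_term u \<alpha> \<beta> (int n))"
proof -
  have ge: "summable (\<lambda>n. anti_term u (\<beta> + int d) \<beta> (int n))" for d \<beta>
  proof (induction d arbitrary: \<beta> rule: nat_induct2)
    case 0
    then show ?case by (simp add: anti_term_def)
  next
    case 1
    have "summable (\<lambda>n. anti_term u (\<beta> + 1) \<beta> (int n) - anti_term u \<beta> (\<beta> + 1) (int n))"
      using anti_term_diff_sums[OF assms] by (rule sums_summable)
    moreover have "anti_term u (\<beta> + 1) \<beta> k - anti_term u \<beta> (\<beta> + 1) k = 2 * anti_term u (\<beta> + 1) \<beta> k" for k
      by (subst anti_term_swap[of u \<beta>]) simp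
    ultimately show ?case by (simp add: summable_cmult_iff)
  next
    case (step d)
    have "summable (\<lambda>n. anti_term u ((\<beta> + 1 + int d) + 1) \<beta> (int n) - anti_term u (\<beta> + 1 + int d) (\<beta> + 1) (int n))"
      using anti_term_diff_sums[OF assms] by (rule sums_summable)
    from summable_add[OF this step.IH[of "\<beta> + 1"]] show ?case
      by (simp add: algebra_simps)
  qed
  show ?thesis
  proof (cases "\<beta> \<le> \<alpha>")
    case True
    then show ?thesis using ge[of \<beta> "nat (\<alpha> - \<beta>)"] by simp
  next
    case False
    then have "summable (\<lambda>n. - anti_term u \<beta> \<alpha> (int n))"
      using ge[of \<alpha> "nat (\<beta> - \<alpha>)"] by (intro summable_minus) simp
    then show ?thesis by (simp flip: anti_term_swap)
  qed
qed

lemma anti_coeff_swap: "anti_coeff u \<beta> \<alpha> = - anti_coeff u \<alpha> \<beta>" if "Re u > - 2 / 3"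
  unfolding anti_coeff_def anti_term_swap[of u \<beta> \<alpha>] by (rule suminf_minus[OF summable_anti_term[OF that]])

text \<open>After summation the telescoping part is gone, and (p - q) A = u (p + q) S holds exactly
  for coefficients.\<close>

lemma anti_coeff_diff:
  assumes "Re u > - 2 / 3"
  shows "anti_coeff u (\<alpha> + 1) \<beta> - anti_coeff u \<alpha> (\<beta> + 1) = u * (sym_coeff u (\<alpha> + 1) \<beta> + sym_coeff u \<alpha> (\<beta> + 1))"
  using sums_unique[OF anti_term_diff_sums[OF assms, of \<alpha> \<beta>]]
    suminf_diff[OF summable_anti_term[OF assms] summable_anti_term[OF assms], of "\<alpha> + 1" \<beta> \<alpha> "\<beta> + 1"]
  by (simp add: anti_coeff_def)

section \<open>Symmetry under permutations of p, q, r and the differential equation\<close>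

lemma suminf_shift_eq:
  fixes f :: "int \<Rightarrow> complex"
  assumes "\<And>k. k < 0 \<Longrightarrow> f k = 0" "\<And>k. k < 0 \<Longrightarrow> f (k + i) = 0"
    and "\<And>j. (\<lambda>n. f (int n + j)) \<longlonglongrightarrow> 0" and "summable (\<lambda>n. f (int n))" and "summable (\<lambda>n. f (int n + i))"
  shows "(\<Sum>n. f (int n + i)) = (\<Sum>n. f (int n))"
proof -
  have "(\<lambda>K. (\<Sum>n<K. f (int n + i)) - (\<Sum>n<K. f (int n))) \<longlonglongrightarrow> (\<Sum>n. f (int n + i)) - (\<Sum>n. f (int n))"
    by (intro tendsto_diff summable_LIMSEQ assms)
  from LIMSEQ_unique[OF this sum_shift_tendsto_0[OF assms(1-3)]] show ?thesis by simp
qed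

lemma A2_coeff_rotate_neg: "k < 0 \<Longrightarrow> A2_coeff u (- \<alpha> - \<beta>) \<alpha> (k + \<alpha>) = 0"
  unfolding A2_coeff_rotate[symmetric] by (rule A2_coeff_neg)

lemma suminf_A2_coeff_rotate:
  assumes "Re u > - 2 / 3"
  shows "(\<Sum>n. A2_coeff u (- \<alpha> - \<beta>) \<alpha> (int n)) = (\<Sum>n. A2_coeff u \<alpha> \<beta> (int n))"
proof -
  have lim: "(\<lambda>n. A2_coeff u (- \<alpha> - \<beta>) \<alpha> (int n + j)) \<longlonglongrightarrow> 0" for j
    using tendsto_linear_A2_coeff[OF assms, of 1 j 0] by simp
  have s: "summable (\<lambda>n. A2_coeff u (- \<alpha> - \<beta>) \<alpha> (int n + \<alpha>))"
    unfolding A2_coeff_rotate[symmetric] by (rule summable_A2_coeff[OF assms])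
  show ?thesis
    using suminf_shift_eq[of "A2_coeff u (- \<alpha> - \<beta>) \<alpha>" \<alpha>, OF A2_coeff_neg A2_coeff_rotate_neg lim
        summable_A2_coeff[OF assms] s]
    unfolding A2_coeff_rotate[symmetric] by simp
qed

text \<open>\<open>- \<alpha> - \<beta>\<close> belongs to r, so this is the exchange of q and r. It
  follows from the rotations of F and the exchange of p and q built into S.\<close>

lemma sym_coeff_third:
  assumes "Re u > - 2 / 3"
  shows "sym_coeff u \<alpha> (- \<alpha> - \<beta>) = sym_coeff u \<alpha> \<beta>"
proof -
  have "(\<Sum>n. A2_coeff u \<alpha> (- \<alpha> - \<beta>) (int n)) = (\<Sum>n. A2_coeff u \<beta> \<alpha> (int n))"
    using suminf_A2_coeff_rotate[OF assms, of \<alpha> "- \<alpha> - \<beta>"] by simp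
  then show ?thesis
    using suminf_A2_coeff_rotate[OF assms, of \<alpha> \<beta>] by (simp add: sym_coeff_eq[OF assms])
qed

text \<open>The equation for \<open>p \<partial>F/\<partial>p\<close> holds termwise once the two summands of each antisymmetric
  coefficient are aligned by rotation.\<close>

lemma sym_anti_equation:
  assumes "Re u > - 2 / 3"
  shows "2 * of_int \<alpha> * sym_coeff u \<alpha> \<beta> + anti_coeff u \<alpha> \<beta> + anti_coeff u \<alpha> (- \<alpha> - \<beta>) = 0"
proof -
  let ?\<gamma> = "- \<alpha> - \<beta>"
  define f where "f k = (2 * of_int k - u) * A2_coeff u ?\<gamma> \<alpha> k" for k
  define g where "g k = (2 * of_int k - u) * A2_coeff u \<alpha> ?\<gamma> k" for k
  have rot1: "A2_coeff u \<alpha> \<beta> k = A2_coeff u ?\<gamma> \<alpha> (k + \<alpha>)" for k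
    by (rule A2_coeff_rotate)
  have rot2: "A2_coeff u \<beta> \<alpha> k = A2_coeff u \<alpha> ?\<gamma> (k - \<alpha>)" for k
    using A2_coeff_rotate[of u \<alpha> ?\<gamma> "k - \<alpha>"] by simp
  have termwise: "2 * of_int \<alpha> * (A2_coeff u \<alpha> \<beta> k + A2_coeff u \<beta> \<alpha> k) + anti_term u \<alpha> \<beta> k + anti_term u \<alpha> ?\<gamma> k =
      (f (k + \<alpha>) - f k) - (g (k + - \<alpha>) - g k)" for k
    unfolding anti_term_def rot1[of k] rot2[of k] f_def g_def by (simp add: algebra_simps)
  have lim: "(\<lambda>n. f (int n + j)) \<longlonglongrightarrow> 0" "(\<lambda>n. g (int n + j)) \<longlonglongrightarrow> 0" for j
    using tendsto_linear_A2_coeff[OF assms, of "- u" j 2] by (simp_all add: f_def g_def algebra_simps)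
  have neg: "f k = 0" "g k = 0" "f (k + \<alpha>) = 0" "g (k + - \<alpha>) = 0" if "k < 0" for k
    using that rot1[of k] rot2[of k] by (simp_all add: f_def g_def A2_coeff_neg)
  \<comment> \<open>\<open>f\<close> and \<open>g\<close> need not be summable, so differences of
    partial sums are taken before the limit.\<close>
  have "(\<lambda>K. ((\<Sum>n<K. f (int n + \<alpha>)) - (\<Sum>n<K. f (int n))) - ((\<Sum>n<K. g (int n + - \<alpha>)) - (\<Sum>n<K. g (int n)))) \<longlonglongrightarrow> 0 - 0"
    by (intro tendsto_diff[of _ 0 _ _ 0] sum_shift_tendsto_0 neg lim)
  then have "(\<lambda>n. (f (int n + \<alpha>) - f (int n)) - (g (int n + - \<alpha>) - g (int n))) sums 0"
    unfolding sums_def by (simp add: sum_subtractf)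
  moreover have "(\<lambda>n. 2 * of_int \<alpha> * (A2_coeff u \<alpha> \<beta> (int n) + A2_coeff u \<beta> \<alpha> (int n)) +
      anti_term u \<alpha> \<beta> (int n) + anti_term u \<alpha> ?\<gamma> (int n)) sums
      (2 * of_int \<alpha> * sym_coeff u \<alpha> \<beta> + anti_coeff u \<alpha> \<beta> + anti_coeff u \<alpha> ?\<gamma>)"
    unfolding sym_coeff_def anti_coeff_def
    by (intro sums_add sums_mult summable_sums summable_add summable_A2_coeff summable_anti_term assms)
  ultimately show ?thesis unfolding termwise by (rule sums_unique2[symmetric])
qed

section \<open>Aomoto's recurrence\<close>

definition compositions3 :: "nat \<Rightarrow> (nat \<times> nat \<times> nat) set" where
  "compositions3 s = {(i, j, k). i + j + k = s}"

lemma finite_compositions3 [simp]: "finite (compositions3 s)"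
  by (rule finite_subset[of _ "{..s} \<times> {..s} \<times> {..s}"]) (auto simp: compositions3_def)

text \<open>\<open>binom_sum v s f\<close> applies the functional \<open>p\<^sup>i q\<^sup>j r\<^sup>k \<mapsto> f i j k\<close> to the part of degree \<open>s\<close> of
  \<open>(1 - p)\<^sup>v (1 - q)\<^sup>v (1 - r)\<^sup>v\<close>.\<close>

definition binom_sum :: "complex \<Rightarrow> nat \<Rightarrow> (int \<Rightarrow> int \<Rightarrow> int \<Rightarrow> complex) \<Rightarrow> complex" where
  "binom_sum v s f = (\<Sum>(i, j, k)\<in>compositions3 s.
     binom_coeff v i * binom_coeff v j * binom_coeff v k * f (int i) (int j) (int k))"

lemma binom_sum_cong:
  assumes "\<And>i j k. i + j + k = int s \<Longrightarrow> f i j k = g i j k"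
  shows "binom_sum v s f = binom_sum v s g"
  unfolding binom_sum_def by (rule sum.cong) (auto simp: compositions3_def assms)

lemma binom_sum_add: "binom_sum v s (\<lambda>i j k. f i j k + g i j k) = binom_sum v s f + binom_sum v s g"
  by (simp add: binom_sum_def algebra_simps sum.distrib case_prod_unfold)

lemma binom_sum_cmult: "binom_sum v s (\<lambda>i j k. c * f i j k) = c * binom_sum v s f"
  by (simp add: binom_sum_def sum_distrib_left case_prod_unfold mult_ac)

lemma binom_sum_swap12: "binom_sum v s (\<lambda>i j k. f j i k) = binom_sum v s f"
  unfolding binom_sum_def
  by (rule sum.reindex_bij_witness[of _ "\<lambda>(i, j, k). (j, i, k)" "\<lambda>(i, j, k). (j, i, k)"])
     (auto simp: compositions3_def mult_ac)

lemma binom_sum_swap13: "binom_sum v s (\<lambda>i j k. f k j i) = binom_sum v s f"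
  unfolding binom_sum_def
  by (rule sum.reindex_bij_witness[of _ "\<lambda>(i, j, k). (k, j, i)" "\<lambda>(i, j, k). (k, j, i)"])
     (auto simp: compositions3_def mult_ac)

text \<open>This is the coefficient form of (1 - p) h' = - v h for h = (1 - p)^v; the weight
  \<open>i\<close> removes the terms with \<open>i = 0\<close>, so the index can be lowered.\<close>

lemma binom_sum_index:
  "binom_sum v (Suc s) (\<lambda>i j k. of_int i * f i j k) = binom_sum v s (\<lambda>i j k. (of_int i - v) * f (i + 1) j k)"
proof -
  let ?g = "\<lambda>(i, j, k). binom_coeff v i * binom_coeff v j * binom_coeff v k * (of_nat i * f (int i) (int j) (int k))"
  have "sum ?g (compositions3 (Suc s)) = sum ?g {t \<in> compositions3 (Suc s). fst t \<noteq> 0}"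
    by (rule sum.mono_neutral_right) auto
  also have "\<dots> = (\<Sum>(i, j, k)\<in>compositions3 s. binom_coeff v i * binom_coeff v j * binom_coeff v k *
      ((of_nat i - v) * f (int i + 1) (int j) (int k)))"
  proof (rule sum.reindex_bij_witness[of _ "\<lambda>(i, j, k). (Suc i, j, k)" "\<lambda>(i, j, k). (i - 1, j, k)"])
    fix t assume "t \<in> {t \<in> compositions3 (Suc s). fst t \<noteq> 0}"
    then obtain i j k where t: "t = (Suc i, j, k)" by (metis (mono_tags) mem_Collect_eq not0_implies_Suc prod.collapse)
    have "binom_coeff v i * binom_coeff v j * binom_coeff v k * ((of_nat i - v) * f (int i + 1) (int j) (int k)) =
       ((of_nat i - v) * binom_coeff v i) * (binom_coeff v j * binom_coeff v k * f (int i + 1) (int j) (int k))"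
      by (simp only: mult_ac)
    also have "\<dots> = (of_nat (Suc i) * binom_coeff v (Suc i)) * (binom_coeff v j * binom_coeff v k * f (int i + 1) (int j) (int k))"
      by (simp only: binom_coeff_Suc)
    finally show "(case (case t of (i, j, k) \<Rightarrow> (i - 1, j, k)) of (i, j, k) \<Rightarrow> binom_coeff v i * binom_coeff v j * binom_coeff v k *
      ((of_nat i - v) * f (int i + 1) (int j) (int k))) = ?g t"
      unfolding t by (simp only: prod.case diff_Suc_1 of_nat_Suc mult_ac add.commute)
  qed (auto simp: compositions3_def)
  finally show ?thesis by (simp add: binom_sum_def)
qed

text \<open>This is the constant term of p^a1 q^a2 r^a3 S times the part of degree \<open>s\<close>
  of the binomial product, where \<open>a3\<close> is implicit in
  \<open>s + a1 + a2 + a3 = 0\<close>.\<close>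

definition moment :: "complex \<Rightarrow> complex \<Rightarrow> nat \<Rightarrow> int \<Rightarrow> int \<Rightarrow> complex" where
  "moment u v s a1 a2 = binom_sum v s (\<lambda>i j k. sym_coeff u (i + a1) (j + a2))"

lemma moment_commute: "moment u v s a1 a2 = moment u v s a2 a1"
  unfolding moment_def
  by (subst binom_sum_swap12[symmetric]) (simp add: sym_coeff_commute[of u "_ + a1"])

text \<open>S and the weights are both symmetric. Together with \<open>moment_commute\<close> this
  shows that all permutations of \<open>a1\<close>, \<open>a2\<close>, \<open>a3\<close> give the
  same moment.\<close>

lemma moment_third:
  assumes "Re u > - 2 / 3" "int s + a1 + a2 + a3 = 0"
  shows "moment u v s a1 a2 = moment u v s a3 a2"
proof -
  have "moment u v s a1 a2 = binom_sum v s (\<lambda>i j k. sym_coeff u (k + a3) (j + a2))"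
    unfolding moment_def
  proof (rule binom_sum_cong)
    fix i j k assume "i + j + k = int s"
    then have "i + a1 = - (j + a2) - (k + a3)" using assms(2) by simp
    have "sym_coeff u (i + a1) (j + a2) = sym_coeff u (j + a2) (- (j + a2) - (k + a3))"
      unfolding \<open>i + a1 = _\<close> by (rule sym_coeff_commute)
    also have "\<dots> = sym_coeff u (j + a2) (k + a3)" by (rule sym_coeff_third[OF assms(1)])
    finally show "sym_coeff u (i + a1) (j + a2) = sym_coeff u (k + a3) (j + a2)"
      by (simp only: sym_coeff_commute)
  qed
  then show ?thesis
    unfolding moment_def using binom_sum_swap13[of v s "\<lambda>i j k. sym_coeff u (i + a3) (j + a2)"] by simp
qed

text \<open>The factor \<open>(p + q) / (p - q)\<close> cancels after symmetrization, as in Aomoto's proof of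
  Selberg's integral.\<close>

lemma binom_sum_anti_coeff:
  assumes u: "Re u > - 2 / 3" and "a1 - a2 \<in> {- 1, 0, 1}"
  shows "binom_sum v s (\<lambda>i j k. anti_coeff u (i + a1) (j + a2)) = of_int (a1 - a2) * u * moment u v s a1 a2"
proof -
  have swap: "binom_sum v s (\<lambda>i j k. anti_coeff u (i + y) (j + x)) = - binom_sum v s (\<lambda>i j k. anti_coeff u (i + x) (j + y))" for x y
  proof -
    have "binom_sum v s (\<lambda>i j k. anti_coeff u (i + y) (j + x)) = binom_sum v s (\<lambda>i j k. (- 1) * anti_coeff u (j + x) (i + y))"
    proof (rule binom_sum_cong)
      fix i j k
      show "anti_coeff u (i + y) (j + x) = (- 1) * anti_coeff u (j + x) (i + y)"
        using anti_coeff_swap[OF u, of "j + x" "i + y"] by simp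
    qed
    then show ?thesis
      using binom_sum_swap12[of v s "\<lambda>i j k. anti_coeff u (i + x) (j + y)"] by (simp only: binom_sum_cmult) simp
  qed
  have one: "binom_sum v s (\<lambda>i j k. anti_coeff u (i + (x + 1)) (j + x)) = u * moment u v s (x + 1) x" for x
  proof -
    have "2 * binom_sum v s (\<lambda>i j k. anti_coeff u (i + (x + 1)) (j + x)) =
       binom_sum v s (\<lambda>i j k. anti_coeff u (i + (x + 1)) (j + x)) + (- 1) * binom_sum v s (\<lambda>i j k. anti_coeff u (i + x) (j + (x + 1)))"
      using swap[of x "x + 1"] by simp
    also have "\<dots> = binom_sum v s (\<lambda>i j k. u * (sym_coeff u (i + (x + 1)) (j + x) + sym_coeff u (i + x) (j + (x + 1))))"
      unfolding binom_sum_add[symmetric] binom_sum_cmult[symmetric]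
      by (rule binom_sum_cong) (use anti_coeff_diff[OF u] in \<open>simp add: add.assoc[symmetric]\<close>)
    also have "\<dots> = u * (moment u v s (x + 1) x + moment u v s x (x + 1))"
      by (simp only: binom_sum_cmult binom_sum_add moment_def)
    finally show ?thesis by (simp add: moment_commute[of u v s x])
  qed
  consider "a1 = a2" | "a1 = a2 + 1" | "a2 = a1 + 1" using assms(2) by force
  then show ?thesis
  proof cases
    case 1
    then show ?thesis using swap[of a1 a1] by simp
  next
    case 2
    then show ?thesis using one[of a2] by simp
  next
    case 3
    then show ?thesis using one[of a1] swap[of a1 a2] by (simp add: moment_commute[of u v s a1])
  qed
qed

text \<open>The functional is applied to \<open>sym_anti_equation\<close>. Exponents at distance at
  most 1 turn both antisymmetric contributions into multiples of the same moment.\<close>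

lemma binom_sum_index_moment:
  assumes u: "Re u > - 2 / 3" and s: "int s + a1 + a2 + a3 = 0"
    and "a1 - a2 \<in> {- 1, 0, 1}" "a1 - a3 \<in> {- 1, 0, 1}"
  shows "binom_sum v s (\<lambda>i j k. of_int i * sym_coeff u (i + a1) (j + a2)) =
     - (of_int a1 + u / 2 * of_int (2 * a1 - a2 - a3)) * moment u v s a1 a2"
proof -
  let ?X = "binom_sum v s (\<lambda>i j k. of_int i * sym_coeff u (i + a1) (j + a2))"
  \<comment> \<open>Permuting the summation variables brings the pair p, r to the pair p, q.\<close>
  have 13: "binom_sum v s (\<lambda>i j k. anti_coeff u (i + a1) (k + a3)) = of_int (a1 - a3) * u * moment u v s a1 a2"
  proof -
    have "binom_sum v s (\<lambda>i j k. anti_coeff u (i + a1) (k + a3)) = binom_sum v s (\<lambda>i j k. anti_coeff u (i + a1) (j + a3))"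
      using binom_sum_swap12[of v s "\<lambda>i j k. anti_coeff u (i + a1) (j + a3)"]
        binom_sum_swap13[of v s "\<lambda>i j k. anti_coeff u (j + a1) (i + a3)"]
        binom_sum_swap12[of v s "\<lambda>i j k. anti_coeff u (j + a1) (k + a3)"] by simp
    also have "\<dots> = of_int (a1 - a3) * u * moment u v s a1 a3"
      by (rule binom_sum_anti_coeff) fact+
    also have "moment u v s a1 a3 = moment u v s a1 a2"
      using moment_third[OF u, of s a3 a1 a2] s by (simp add: moment_commute[of u v s a1] add_ac)
    finally show ?thesis .
  qed
  have "0 = binom_sum v s (\<lambda>i j k. 2 * (of_int i * sym_coeff u (i + a1) (j + a2)) +
      (2 * of_int a1) * sym_coeff u (i + a1) (j + a2) +
      anti_coeff u (i + a1) (j + a2) + anti_coeff u (i + a1) (k + a3))"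
  proof -
    have "binom_sum v s (\<lambda>i j k. 2 * (of_int i * sym_coeff u (i + a1) (j + a2)) +
      (2 * of_int a1) * sym_coeff u (i + a1) (j + a2) +
      anti_coeff u (i + a1) (j + a2) + anti_coeff u (i + a1) (k + a3)) = binom_sum v s (\<lambda>i j k. 0)"
    proof (rule binom_sum_cong)
      fix i j k assume "i + j + k = int s"
      then have k: "k + a3 = - (i + a1) - (j + a2)" using s by simp
      show "2 * (of_int i * sym_coeff u (i + a1) (j + a2)) + (2 * of_int a1) * sym_coeff u (i + a1) (j + a2) +
        anti_coeff u (i + a1) (j + a2) + anti_coeff u (i + a1) (k + a3) = 0"
        unfolding k using sym_anti_equation[OF u, of "i + a1" "j + a2"] by (simp add: algebra_simps)
    qed
    then show ?thesis by (simp add: binom_sum_def)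
  qed
  also have "\<dots> = 2 * ?X + (2 * of_int a1) * moment u v s a1 a2 + of_int (a1 - a2) * u * moment u v s a1 a2 +
      of_int (a1 - a3) * u * moment u v s a1 a2"
    unfolding binom_sum_add binom_sum_cmult 13 binom_sum_anti_coeff[OF u assms(3)] moment_def[symmetric] ..
  finally have "2 * ?X = 2 * (- (of_int a1 + u / 2 * of_int (2 * a1 - a2 - a3)) * moment u v s a1 a2)"
    by (simp add: algebra_simps add_eq_0_iff)
  then show ?thesis by simp
qed

text \<open>The sum weighted by \<open>i\<close> is evaluated in degree \<open>Suc s\<close> and
  again after \<open>binom_sum_index\<close>. The hypotheses keep both \<open>a1\<close> and
  \<open>a1 + 1\<close> within distance 1 of \<open>a2\<close> and \<open>a3\<close>.\<close>

lemma moment_step: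
  assumes u: "Re u > - 2 / 3" and s: "int s + 1 + a1 + a2 + a3 = 0"
    and "a1 - a2 \<in> {- 1, 0}" "a1 - a3 \<in> {- 1, 0}"
  shows "(of_int a1 + u / 2 * of_int (2 * a1 - a2 - a3)) * moment u v (Suc s) a1 a2 =
     (of_int a1 + 1 + v + u / 2 * of_int (2 * a1 + 2 - a2 - a3)) * moment u v s (a1 + 1) a2"
proof -
  have "- (of_int a1 + u / 2 * of_int (2 * a1 - a2 - a3)) * moment u v (Suc s) a1 a2 =
      binom_sum v (Suc s) (\<lambda>i j k. of_int i * sym_coeff u (i + a1) (j + a2))"
    using assms(3,4) s by (intro binom_sum_index_moment[OF u, symmetric]) auto
  also have "\<dots> = binom_sum v s (\<lambda>i j k. (of_int i - v) * sym_coeff u (i + 1 + a1) (j + a2))"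
    by (rule binom_sum_index)
  also have "\<dots> = binom_sum v s (\<lambda>i j k. of_int i * sym_coeff u (i + (a1 + 1)) (j + a2) +
      (- v) * sym_coeff u (i + (a1 + 1)) (j + a2))"
    by (rule binom_sum_cong) (simp add: algebra_simps)
  also have "\<dots> = - (of_int (a1 + 1) + u / 2 * of_int (2 * (a1 + 1) - a2 - a3)) * moment u v s (a1 + 1) a2
      - v * moment u v s (a1 + 1) a2"
    unfolding binom_sum_add binom_sum_cmult moment_def[symmetric]
    using assms(3,4) s by (subst binom_sum_index_moment[OF u, of s "a1 + 1" a2 a3]) auto
  finally have eq: "- (of_int a1 + u / 2 * of_int (2 * a1 - a2 - a3)) * moment u v (Suc s) a1 a2 =
      - (of_int (a1 + 1) + u / 2 * of_int (2 * (a1 + 1) - a2 - a3)) * moment u v s (a1 + 1) a2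
      - v * moment u v s (a1 + 1) a2" .
  have solve: "A * M = C * N" if "- A * M = - B * N - v * N" "B + v = C" for A B C M N :: complex
  proof -
    have "- (A * M) = - (B * N + v * N)" using that(1) by simp
    then have "A * M = (B + v) * N" by (simp only: neg_equal_iff_equal distrib_right)
    then show ?thesis by (simp only: that(2))
  qed
  show ?thesis by (rule solve[OF eq]) simp
qed

text \<open>Three uses of \<open>moment_step\<close> raise the exponents one by one from -(b+1) to
  -b while the degree falls from 3b+3 to 3b; symmetry first moves an unraised exponent to the
  front.\<close>

lemma moment_recurrence:
  assumes u: "Re u > - 2 / 3"
  shows "(of_nat b + 1) * (of_nat b + 1 + u / 2) * (of_nat b + 1 + u) *
       moment u v (3 * Suc b) (- int (Suc b)) (- int (Suc b)) =
     (of_nat b - v) * (of_nat b - v - u / 2) * (of_nat b - v - u) * moment u v (3 * b) (- int b) (- int b)"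
proof -
  define m0 m1 m2 m3 where "m0 = moment u v (Suc (Suc (Suc (3 * b)))) (- int (Suc b)) (- int (Suc b))"
    and "m1 = moment u v (Suc (Suc (3 * b))) (- int b) (- int (Suc b))"
    and "m2 = moment u v (Suc (3 * b)) (- int b) (- int b)"
    and "m3 = moment u v (3 * b) (- int b) (- int b)"
  have m1: "m1 = moment u v (Suc (Suc (3 * b))) (- int (Suc b)) (- int b)"
    unfolding m1_def by (rule moment_commute)
  have m2: "m2 = moment u v (Suc (3 * b)) (- int (Suc b)) (- int b)"
    unfolding m2_def by (rule moment_third[OF u]) simp
  have 1: "(of_nat b + 1) * m0 = (of_nat b - v - u) * m1"
    using moment_step[OF u, of "Suc (Suc (3 * b))" "- int (Suc b)" "- int (Suc b)" "- int (Suc b)" v]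
    by (simp add: m0_def m1_def algebra_simps)
  have 2: "(of_nat b + 1 + u / 2) * m1 = (of_nat b - v - u / 2) * m2"
    using moment_step[OF u, of "Suc (3 * b)" "- int (Suc b)" "- int b" "- int (Suc b)" v]
    by (simp add: m1 m2_def algebra_simps)
  have 3: "(of_nat b + 1 + u) * m2 = (of_nat b - v) * m3"
    using moment_step[OF u, of "3 * b" "- int (Suc b)" "- int b" "- int b" v]
    by (simp add: m2 m3_def algebra_simps)
  have "(of_nat b + 1) * (of_nat b + 1 + u / 2) * (of_nat b + 1 + u) * m0 =
      (of_nat b + 1 + u / 2) * (of_nat b + 1 + u) * ((of_nat b + 1) * m0)" by (simp only: mult_ac)
  also have "\<dots> = (of_nat b + 1 + u) * (of_nat b - v - u) * ((of_nat b + 1 + u / 2) * m1)"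
    unfolding 1 by (simp only: mult_ac)
  also have "\<dots> = (of_nat b - v - u) * (of_nat b - v - u / 2) * ((of_nat b + 1 + u) * m2)"
    unfolding 2 by (simp only: mult_ac)
  also have "\<dots> = (of_nat b - v) * (of_nat b - v - u / 2) * (of_nat b - v - u) * m3"
    unfolding 3 by (simp only: mult_ac)
  finally have "(of_nat b + 1) * (of_nat b + 1 + u / 2) * (of_nat b + 1 + u) * m0 =
      (of_nat b - v) * (of_nat b - v - u / 2) * (of_nat b - v - u) * m3" .
  moreover have "3 * Suc b = Suc (Suc (Suc (3 * b)))" by simp
  ultimately show ?thesis by (simp only: m0_def m3_def)
qed

section \<open>The slices and their sum\<close>

text \<open>The free index \<open>n\<close> is \<open>m2\<close>; the exponents \<open>m1\<close>
  and \<open>m3\<close> are determined by it, and negative values of them give 0 through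
  \<open>binom_ext\<close>.\<close>

definition slice_term :: "complex \<Rightarrow> complex \<Rightarrow> nat \<Rightarrow> (nat \<times> nat \<times> nat) \<times> nat \<Rightarrow> complex" where
  "slice_term u v b = (\<lambda>((i, j, k), n). binom_coeff v i * binom_coeff v j * binom_coeff v k *
     A2_coeff u (int i - int b) (int j - int b) (int n))"

lemma contributing_iff:
  "((m1, m2, m3), (n1, n2, n3)) \<in> contributing b \<longleftrightarrow>
     (n1, n2, n3) \<in> compositions3 (3 * b) \<and>
     int m1 = int m2 + (int n1 - int b) \<and> int m3 = int m2 - (int n2 - int b)"
  unfolding contributing_def compositions3_def by (simp add: zero_prod_def) linarith

text \<open>\<open>T\<close> is taken to be the norm for absolute convergence and the identity for
  the value; \<open>T 0 = 0\<close> allows the index set to be enlarged to a full product.\<close>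

lemma has_sum_contributing:
  fixes T :: "complex \<Rightarrow> 'a :: {comm_monoid_add, topological_space}"
  assumes T: "T 0 = 0"
  shows "((\<lambda>p. T (term_coeff u v p)) has_sum X) (contributing b) \<longleftrightarrow>
     ((\<lambda>t. T (slice_term u v b t)) has_sum X) (compositions3 (3 * b) \<times> UNIV)"
proof -
  let ?\<phi> = "\<lambda>((m1, m2, m3), n). (n, m2) :: (nat \<times> nat \<times> nat) \<times> nat"
  have inj: "inj_on ?\<phi> (contributing b)"
    by (rule inj_onI) (auto simp: contributing_iff)
  have coeff: "slice_term u v b (?\<phi> p) = term_coeff u v p" if "p \<in> contributing b" for p
  proof -
    obtain m1 m2 m3 n1 n2 n3 where p: "p = ((m1, m2, m3), (n1, n2, n3))" by (metis prod.exhaust)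
    have "int m2 + (int n1 - int b) = int m1" "int m2 - (int n2 - int b) = int m3"
      using that by (simp_all only: p contributing_iff)
    then show ?thesis
      by (simp add: p slice_term_def A2_coeff_def binom_ext_of_nat mult_ac)
  qed
  have "((\<lambda>p. T (term_coeff u v p)) has_sum X) (contributing b) \<longleftrightarrow>
      (((\<lambda>t. T (slice_term u v b t)) \<circ> ?\<phi>) has_sum X) (contributing b)"
    by (rule has_sum_cong) (simp add: coeff)
  also have "\<dots> \<longleftrightarrow> ((\<lambda>t. T (slice_term u v b t)) has_sum X) (?\<phi> ` contributing b)"
    by (rule has_sum_reindex[OF inj, symmetric])
  also have "\<dots> \<longleftrightarrow> ((\<lambda>t. T (slice_term u v b t)) has_sum X) (compositions3 (3 * b) \<times> UNIV)"
  proof (rule has_sum_cong_neutral)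
    fix t assume "t \<in> (compositions3 (3 * b) \<times> UNIV) - ?\<phi> ` contributing b"
    moreover obtain n1 n2 n3 m2 where t: "t = ((n1, n2, n3), m2)" by (metis prod.exhaust)
    ultimately have n: "(n1, n2, n3) \<in> compositions3 (3 * b)" and nin: "t \<notin> ?\<phi> ` contributing b" by auto
    have "int m2 + (int n1 - int b) < 0 \<or> int m2 - (int n2 - int b) < 0"
    proof (rule ccontr)
      assume "\<not> ?thesis"
      then have "((nat (int m2 + (int n1 - int b)), m2, nat (int m2 - (int n2 - int b))), (n1, n2, n3)) \<in> contributing b"
        using n by (simp add: contributing_iff)
      with nin show False unfolding t by (force simp: image_iff)
    qed
    then show "T (slice_term u v b t) = 0"
      by (auto simp: t slice_term_def A2_coeff_def binom_ext_neg T)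
  next
    fix t assume "t \<in> ?\<phi> ` contributing b - (compositions3 (3 * b) \<times> UNIV)"
    then show "T (slice_term u v b t) = 0" by (auto simp: contributing_iff)
  qed simp
  finally show ?thesis .
qed

text \<open>There are finitely many compositions, so only the series over \<open>m2\<close> matters.
  The factor 1/2 arises because F and its image under the exchange of p and q contribute equally to
  S.\<close>

lemma slice_summable_and_eq:
  assumes u: "Re u > - 2 / 3"
  shows "(\<lambda>p. norm (term_coeff u v p)) summable_on contributing b"
    and "slice u v b = moment u v (3 * b) (- int b) (- int b) / 2"
proof -
  let ?S = "compositions3 (3 * b) \<times> (UNIV :: nat set)"
  let ?d = "\<lambda>(i, j, k). binom_coeff v i * binom_coeff v j * binom_coeff v k"
  let ?A = "\<lambda>(i, j, k) n. A2_coeff u (int i - int b) (int j - int b) (int n)"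
  have st: "slice_term u v b (t, n) = ?d t * ?A t n" for t n
    by (cases t) (simp add: slice_term_def)
  have sn: "summable (\<lambda>n. norm (slice_term u v b (t, n)))" for t
    unfolding st norm_mult by (cases t) (simp add: summable_mult summable_norm_A2_coeff[OF u])
  have norm_sum: "(\<lambda>t. norm (slice_term u v b t)) summable_on ?S"
  proof (rule summable_on_SigmaI)
    fix t
    show "((\<lambda>n. norm (slice_term u v b (t, n))) has_sum (\<Sum>n. norm (slice_term u v b (t, n)))) UNIV"
      by (rule norm_summable_imp_has_sum) (use sn in \<open>simp_all add: summable_sums\<close>)
  qed simp_all
  then show "(\<lambda>p. norm (term_coeff u v p)) summable_on contributing b"
    by (simp add: summable_on_def has_sum_contributing[of norm, OF norm_zero])
  have "(slice_term u v b has_sum (\<Sum>t\<in>compositions3 (3 * b). \<Sum>n. slice_term u v b (t, n))) ?S"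
  proof (rule has_sum_SigmaI)
    fix t
    show "((\<lambda>n. slice_term u v b (t, n)) has_sum (\<Sum>n. slice_term u v b (t, n))) UNIV"
      by (rule norm_summable_imp_has_sum) (use sn summable_norm_cancel[OF sn] in \<open>simp_all add: summable_sums\<close>)
  next
    show "slice_term u v b summable_on ?S" by (rule abs_summable_summable[OF norm_sum])
  qed simp
  then have "(term_coeff u v has_sum (\<Sum>t\<in>compositions3 (3 * b). \<Sum>n. slice_term u v b (t, n))) (contributing b)"
    by (simp add: has_sum_contributing[of "\<lambda>x. x", OF refl])
  then have "slice u v b = (\<Sum>t\<in>compositions3 (3 * b). \<Sum>n. slice_term u v b (t, n))"
    unfolding slice_def by (rule infsumI)
  also have "\<dots> = binom_sum v (3 * b) (\<lambda>i j k. \<Sum>n. A2_coeff u (i - int b) (j - int b) (int n))"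
    unfolding binom_sum_def
    by (rule sum.cong) (auto simp: slice_term_def intro!: suminf_mult summable_A2_coeff[OF u])
  finally have "slice u v b = binom_sum v (3 * b) (\<lambda>i j k. \<Sum>n. A2_coeff u (i - int b) (j - int b) (int n))"
    (is "_ = ?L") .
  moreover have "moment u v (3 * b) (- int b) (- int b) = ?L + ?L"
  proof -
    have "moment u v (3 * b) (- int b) (- int b) = ?L +
        binom_sum v (3 * b) (\<lambda>i j k. \<Sum>n. A2_coeff u (j - int b) (i - int b) (int n))"
      unfolding moment_def sym_coeff_eq[OF u] binom_sum_add[symmetric] by simp
    then show ?thesis
      using binom_sum_swap12[of v "3 * b" "\<lambda>i j k. \<Sum>n. A2_coeff u (i - int b) (j - int b) (int n)"] by simp
  qed
  ultimately show "slice u v b = moment u v (3 * b) (- int b) (- int b) / 2" by simp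
qed

lemma dixon_term_Suc:
  "dixon_term a b c (Suc n) = dixon_term a b c n *
     ((a + of_nat n) * (b + of_nat n) * (c + of_nat n) /
      ((of_nat n + 1) * (1 + a - b + of_nat n) * (1 + a - c + of_nat n)))"
  by (simp add: dixon_term_def pochhammer_Suc mult_ac)

text \<open>Only the constant term of F remains, the sum of ((-u)_n / n!)^3, which is the
  well-poised series with all upper parameters \<open>- u\<close>.\<close>

lemma slice_zero:
  assumes u: "Re u > - 2 / 3"
  shows "slice u v 0 = dixon_value (- u) (- u) (- u)"
proof -
  have "compositions3 0 = {(0, 0, 0)}" by (auto simp: compositions3_def)
  then have "slice u v 0 = sym_coeff u 0 0 / 2"
    using slice_summable_and_eq(2)[OF u, of v 0]
    by (simp add: moment_def binom_sum_def binom_coeff_eq_pochhammer)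
  also have "\<dots> = (\<Sum>n. A2_coeff u 0 0 (int n))"
    by (simp add: sym_coeff_eq[OF u])
  also have "\<dots> = suminf (dixon_term (- u) (- u) (- u))"
  proof -
    have "(\<lambda>n. A2_coeff u 0 0 (int n)) = dixon_term (- u) (- u) (- u)"
      by (rule ext) (simp add: A2_coeff_def binom_ext_of_nat binom_coeff_eq_pochhammer dixon_term_def
          pochhammer_fact[symmetric])
    then show ?thesis by simp
  qed
  also have "\<dots> = dixon_value (- u) (- u) (- u)"
    by (rule dixon) (use u in simp_all)
  finally show ?thesis .
qed

text \<open>The case of three variables of a complex analogue of Morris' constant term identity.\<close>

lemma slice_closed_form:
  assumes u: "Re u > - 2 / 3"
  shows "slice u v b = dixon_value (- u) (- u) (- u) * dixon_term (- v) (- v - u / 2) (- v - u) b"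
proof (induction b)
  case 0
  show ?case by (simp add: slice_zero[OF u] dixon_term_def)
next
  case (Suc b)
  define X where "X = (of_nat b + 1) * (of_nat b + 1 + u / 2) * (of_nat b + 1 + u)"
  define Y where "Y = (of_nat b - v) * (of_nat b - v - u / 2) * (of_nat b - v - u)"
  have "Re (of_nat b + 1) > 0" "Re (of_nat b + 1 + u / 2) > 0" "Re (of_nat b + 1 + u) > 0"
    using u by simp_all
  moreover have "z \<noteq> 0" if "Re z > 0" for z
    using that by auto
  ultimately have X: "X \<noteq> 0" unfolding X_def by (intro no_zero_divisors)
  have "X * slice u v (Suc b) = Y * slice u v b"
    using moment_recurrence[OF u, of b v]
    by (simp add: slice_summable_and_eq(2)[OF u] X_def Y_def)
  then have "slice u v (Suc b) = slice u v b * (Y / X)" using X by (simp add: field_simps)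
  \<comment> \<open>The ratio of the recurrence is the term ratio of a well-poised series, since
    \<open>1 + a - b\<close> is \<open>1 + u / 2\<close> and \<open>1 + a - c\<close> is
    \<open>1 + u\<close>.\<close>
  moreover have "dixon_term (- v) (- v - u / 2) (- v - u) (Suc b) = dixon_term (- v) (- v - u / 2) (- v - u) b * (Y / X)"
  proof -
    have args: "- v + of_nat b = of_nat b - v" "- v - u / 2 + of_nat b = of_nat b - v - u / 2"
      "- v - u + of_nat b = of_nat b - v - u" "1 + - v - (- v - u / 2) + of_nat b = of_nat b + 1 + u / 2"
      "1 + - v - (- v - u) + of_nat b = of_nat b + 1 + u"
      by simp_all
    show ?thesis unfolding dixon_term_Suc X_def Y_def args ..
  qed
  ultimately show ?case using Suc by simp
qed

section \<open>The Gamma quotient without its removable singularities\<close>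

definition half_factor :: "complex \<Rightarrow> complex" where
  "half_factor w = of_real (sqrt pi) * exp (w * of_real (ln 2)) * rGamma ((1 - w) / 2)"

text \<open>The reflection formula splits the cosine into \<open>rGamma ((1 + w) / 2)\<close> and
  \<open>rGamma ((1 - w) / 2)\<close>; the duplication formula absorbs the first, leaving an entire
  function of \<open>w\<close>.\<close>

lemma half_factor_eq:
  assumes "1 + w \<notin> \<int>\<^sub>\<le>\<^sub>0"
  shows "cos (1 / 2 * of_real pi * w) * Gamma (1 + w) / Gamma (1 + 1 / 2 * w) = half_factor w"
proof -
  have n1: "(1 + w) / 2 \<notin> \<int>\<^sub>\<le>\<^sub>0"
  proof
    assume "(1 + w) / 2 \<in> \<int>\<^sub>\<le>\<^sub>0"
    then obtain k where "(1 + w) / 2 = - of_nat k" by (elim nonpos_Ints_cases')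
    then have "1 + w = - of_nat (2 * k)" by (simp add: field_simps)
    with assms show False by (simp only: minus_of_nat_in_nonpos_Ints) simp
  qed
  have n2: "(1 + w) / 2 + 1 / 2 \<notin> \<int>\<^sub>\<le>\<^sub>0"
  proof
    assume "(1 + w) / 2 + 1 / 2 \<in> \<int>\<^sub>\<le>\<^sub>0"
    then obtain k where "(1 + w) / 2 + 1 / 2 = - of_nat k" by (elim nonpos_Ints_cases')
    then have "w = - 2 * of_nat k - 2" by (simp add: field_simps)
    then have "1 + w = - of_nat (2 * k + 1)" by simp
    with assms show False by (simp only: minus_of_nat_in_nonpos_Ints) simp
  qed
  have args: "(1 + w) / 2 + 1 / 2 = 1 + 1 / 2 * w" "2 * ((1 + w) / 2) = 1 + w" "1 - (1 + w) = - w"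
    "1 - (1 + w) / 2 = (1 - w) / 2"
    by (simp_all add: field_simps)
  have dup: "Gamma ((1 + w) / 2) * Gamma (1 + 1 / 2 * w) =
      exp (- w * of_real (ln 2)) * of_real (sqrt pi) * Gamma (1 + w)"
    using Gamma_legendre_duplication[OF n1 n2] by (simp only: args)
  have sincos: "sin (of_real pi * ((1 + w) / 2)) = cos (1 / 2 * of_real pi * w)"
  proof -
    have "of_real pi / 2 - of_real pi * ((1 + w) / 2) = - (1 / 2 * of_real pi * w)"
      by (simp add: field_simps)
    then show ?thesis by (simp only: sin_cos_eq cos_minus)
  qed
  have refl: "rGamma ((1 + w) / 2) * rGamma ((1 - w) / 2) = cos (1 / 2 * of_real pi * w) / of_real pi"
    using rGamma_reflection_complex[of "(1 + w) / 2"] by (simp only: args sincos)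
  have nz: "Gamma ((1 + w) / 2) \<noteq> 0" "Gamma (1 + 1 / 2 * w) \<noteq> 0"
    using n1 n2 by (simp_all only: Gamma_eq_zero_iff args not_False_eq_True)
  have sq: "of_real (sqrt pi) * of_real (sqrt pi) = (of_real pi :: complex)"
    by (simp flip: of_real_mult)
  have ex: "exp (w * of_real (ln 2)) * exp (- w * of_real (ln 2)) = 1"
    by (simp flip: exp_add)
  have "cos (1 / 2 * of_real pi * w) =
      of_real (sqrt pi) * of_real (sqrt pi) * (rGamma ((1 + w) / 2) * rGamma ((1 - w) / 2))"
    unfolding sq refl by simp
  then have "cos (1 / 2 * of_real pi * w) * Gamma (1 + w) =
      of_real (sqrt pi) * of_real (sqrt pi) * (rGamma ((1 + w) / 2) * rGamma ((1 - w) / 2)) *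
      (exp (w * of_real (ln 2)) * exp (- w * of_real (ln 2))) * Gamma (1 + w)"
    by (simp only: ex mult_1_right)
  also have "\<dots> = of_real (sqrt pi) * rGamma ((1 - w) / 2) * rGamma ((1 + w) / 2) *
      (exp (w * of_real (ln 2)) * (exp (- w * of_real (ln 2)) * of_real (sqrt pi) * Gamma (1 + w)))"
    by (simp only: mult_ac)
  also have "\<dots> = half_factor w * (rGamma ((1 + w) / 2) * Gamma ((1 + w) / 2)) * Gamma (1 + 1 / 2 * w)"
    unfolding dup[symmetric] half_factor_def by (simp only: mult_ac)
  also have "\<dots> = half_factor w * Gamma (1 + 1 / 2 * w)"
    using nz by (simp add: rGamma_inverse_Gamma)
  finally show ?thesis using nz by simp
qed

text \<open>This is the continuous extension of \<open>closed_form\<close> in \<open>w\<close>: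
  poles can come only from the two remaining \<open>Gamma\<close> factors, whose arguments have
  positive real part under the hypotheses of the theorem.\<close>

definition regular_form :: "complex \<Rightarrow> complex \<Rightarrow> complex" where
  "regular_form u w = half_factor u * half_factor w *
     Gamma (1 + 3/2 * (u + w)) * Gamma (1 + 3/2 * u) * rGamma (1 + 3/2 * u + w) *
     rGamma (1 + u + 1/2 * w) * rGamma (1 + 1/2 * (u + w)) * rGamma (1 + 1/2 * u)"

lemma closed_form_eq_regular_form:
  assumes "1 + u \<notin> \<int>\<^sub>\<le>\<^sub>0" "1 + w \<notin> \<int>\<^sub>\<le>\<^sub>0"
  shows "closed_form u w = regular_form u w"
proof -
  have "closed_form u w =
     (cos (1/2 * of_real pi * u) * Gamma (1 + u) / Gamma (1 + 1/2 * u)) *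
     (cos (1/2 * of_real pi * w) * Gamma (1 + w) / Gamma (1 + 1/2 * w)) *
     Gamma (1 + 3/2 * (u + w)) * Gamma (1 + 3/2 * u) * inverse (Gamma (1 + 3/2 * u + w)) *
     inverse (Gamma (1 + u + 1/2 * w)) * inverse (Gamma (1 + 1/2 * (u + w))) * inverse (Gamma (1 + 1/2 * u))"
    unfolding closed_form_def power2_eq_square
    by (simp only: divide_inverse inverse_mult_distrib mult_ac)
  then show ?thesis
    by (simp only: half_factor_eq[OF assms(1)] half_factor_eq[OF assms(2)] regular_form_def rGamma_inverse_Gamma)
qed

lemma isCont_regular_form:
  assumes "Re (1 + 3/2 * (u + v)) > 0"
  shows "isCont (regular_form u) v"
proof -
  have Gamma: "isCont (\<lambda>w. Gamma (1 + 3/2 * (u + w))) v"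
    using Re_pos_not_nonpos_Int[OF assms] by (intro isCont_Gamma) simp_all
  have rGamma: "isCont (\<lambda>w. rGamma ((1 - w) / 2)) v" "isCont (\<lambda>w. rGamma (1 + 3/2 * u + w)) v"
    "isCont (\<lambda>w. rGamma (1 + u + 1/2 * w)) v" "isCont (\<lambda>w. rGamma (1 + 1/2 * (u + w))) v"
    by (rule isCont_rGamma, simp)+
  have exp: "isCont (\<lambda>w. exp (w * of_real (ln 2)) :: complex) v"
    by simp
  show ?thesis
    unfolding regular_form_def half_factor_def by (intro isCont_mult Gamma rGamma exp continuous_const)
qed

text \<open>The first value comes from the slice \<open>b = 0\<close>, the second from the sum over
  \<open>b\<close>. In the product \<open>Gamma (1 + u)\<close> and one of two factors
  \<open>rGamma (1 + 1/2 * u)\<close> cancel.\<close>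

lemma regular_form_eq_dixon:
  assumes u: "Re u > - 2 / 3"
  shows "dixon_value (- u) (- u) (- u) * dixon_value (- v) (- v - u / 2) (- v - u) = regular_form u v"
proof -
  have nz: "Gamma (1 + u) \<noteq> 0" "Gamma (1 + 1/2 * u) \<noteq> 0"
    unfolding Gamma_eq_zero_iff using u by (intro Re_pos_not_nonpos_Int; simp)+
  have 1: "dixon_value (- u) (- u) (- u) = half_factor u * Gamma (1 + 3/2 * u) * rGamma (1 + u) *
      (rGamma (1 + 1/2 * u) * rGamma (1 + 1/2 * u))"
  proof -
    have args: "(1 + - u) / 2 = (1 - u) / 2" "1 + - u / 2 - - u - - u = 1 + 3/2 * u" "1 + - u - - u = 1"
      "1 - - u = 1 + u" "1 + - u / 2 - - u = 1 + 1/2 * u"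
      by (simp_all add: field_simps)
    show ?thesis unfolding dixon_value_def half_factor_def args by (simp add: mult_ac add_ac)
  qed
  have 2: "dixon_value (- v) (- v - u / 2) (- v - u) = half_factor v * Gamma (1 + 3/2 * (u + v)) *
      Gamma (1 + 1/2 * u) * Gamma (1 + u) * rGamma (1 + 3/2 * u + v) * rGamma (1 + 1/2 * (u + v)) * rGamma (1 + u + 1/2 * v)"
  proof -
    have args: "1 + - v / 2 - (- v - u / 2) - (- v - u) = 1 + 3/2 * (u + v)" "1 + - v - (- v - u / 2) = 1 + 1/2 * u"
      "1 + - v - (- v - u) = 1 + u" "1 + - v - (- v - u / 2) - (- v - u) = 1 + 3/2 * u + v"
      "1 + - v / 2 - (- v - u / 2) = 1 + 1/2 * (u + v)" "1 + - v / 2 - (- v - u) = 1 + u + 1/2 * v"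
      by (simp_all add: field_simps)
    have "dixon_value (- v) (- v - u / 2) (- v - u) = of_real (sqrt pi) * exp (v * of_real (ln 2)) * rGamma ((1 - v) / 2) *
        Gamma (1 + 3/2 * (u + v)) * Gamma (1 + 1/2 * u) * Gamma (1 + u) * rGamma (1 + 3/2 * u + v) *
        rGamma (1 + 1/2 * (u + v)) * rGamma (1 + u + 1/2 * v)"
      unfolding dixon_value_def args(1) unfolding args(4) unfolding args(2,3,5,6) by simp
    then show ?thesis by (simp only: half_factor_def mult_ac)
  qed
  show ?thesis
    unfolding 1 2 regular_form_def rGamma_inverse_Gamma using nz by (simp add: field_simps)
qed

theorem theorem6p1:
  fixes u v :: complex
  assumes "Re (1 + 3/2 * u) > 0"
    and "Re (1 + 3/2 * (u + v)) > 0"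
  shows "CT_converges u v \<and>
    CT u v = (if 1 + v \<in> \<int>\<^sub>\<le>\<^sub>0 then Lim (at v) (\<lambda>w. closed_form u w) else closed_form u v)"
proof -
  have u: "Re u > - 2 / 3" using assms(1) by simp
  have nu: "1 + u \<notin> \<int>\<^sub>\<le>\<^sub>0" "1 + u / 2 \<notin> \<int>\<^sub>\<le>\<^sub>0"
    using u by (intro Re_pos_not_nonpos_Int; simp)+
  let ?t = "dixon_term (- v) (- v - u / 2) (- v - u)"
  have B: "1 + - v - (- v - u / 2) \<notin> \<int>\<^sub>\<le>\<^sub>0" and C: "1 + - v - (- v - u) \<notin> \<int>\<^sub>\<le>\<^sub>0"
    using nu by (simp_all add: algebra_simps)
  have R: "Re (1 + - v / 2 - (- v - u / 2) - (- v - u)) > 0" using assms(2) by (simp add: add_divide_distrib)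
  have slice: "slice u v = (\<lambda>b. dixon_value (- u) (- u) (- u) * ?t b)"
    using slice_closed_form[OF u] by auto
  have t: "summable ?t" using summable_dixon_term[OF B C R] by (rule summable_norm_cancel)
  have conv: "CT_converges u v"
    unfolding CT_converges_def slice using slice_summable_and_eq(1)[OF u] t by (simp add: summable_mult)
  have CT: "CT u v = regular_form u v"
    unfolding CT_def slice suminf_mult[OF t] dixon[OF B C R] by (rule regular_form_eq_dixon[OF u])
  show ?thesis
  proof (cases "1 + v \<in> \<int>\<^sub>\<le>\<^sub>0")
    case False
    then show ?thesis using conv CT closed_form_eq_regular_form[OF nu(1) False] by simp
  next
    case True
    \<comment> \<open>Within distance 1 of \<open>v\<close>, no other \<open>w\<close> makes
      \<open>1 + w\<close> an integer, so the two forms agree on a punctured neighbourhood.\<close>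
    have "eventually (\<lambda>w. regular_form u w = closed_form u w) (at v)"
      unfolding eventually_at
    proof (intro exI conjI ballI impI)
      fix w assume w: "w \<noteq> v \<and> dist w v < 1"
      have "1 + w \<notin> \<int>\<^sub>\<le>\<^sub>0"
      proof
        assume "1 + w \<in> \<int>\<^sub>\<le>\<^sub>0"
        then obtain k l where "1 + w = of_int k" "1 + v = of_int l"
          using True by (auto elim!: nonpos_Ints_cases)
        moreover have "w - v = (1 + w) - (1 + v)" by simp
        ultimately have "w - v = of_int (k - l)" by (simp only: of_int_diff)
        then have "real_of_int \<bar>k - l\<bar> < 1" "k \<noteq> l"
          using w by (auto simp: dist_norm simp flip: of_int_diff)
        then show False by linarith
      qed
      then show "regular_form u w = closed_form u w"
        using closed_form_eq_regular_form[OF nu(1)] by simp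
    qed simp
    moreover have "(regular_form u \<longlongrightarrow> regular_form u v) (at v)"
      using isCont_regular_form[OF assms(2)] by (simp add: isCont_def)
    ultimately have "(closed_form u \<longlongrightarrow> regular_form u v) (at v)"
      by (rule Lim_transform_eventually[rotated])
    then have "Lim (at v) (closed_form u) = regular_form u v"
      by (intro tendsto_Lim) auto
    then show ?thesis using True conv CT by simp
  qed
qed

end
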